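(* Let $Q$ be a quiver without oriented cycles, let $M$ be a finite-dimensional complex representation of $Q$ with ordered basis $\mathcal B$ and dimension vector $d$, let $e\in\mathbb NQ_0$ with $e\le d$, and put $e^*=d-e$. Then the association $U\mapsto U^*$ defines an isomorphism of varieties $\mathrm{Gr}_e(M)\to\mathrm{Gr}_{e^*}(M^* )$, and it restricts to an isomorphism $C^M_\beta\to C^{M^*}_{\beta^*}$ between Schubert cells for every subset $\beta$ of $\mathcal B$ (of type $e$).
   Context: $M^*$ is the dual representation of the opposite quiver $Q^{\mathrm{op}}$, given by the dual vector spaces $M_q^*$ and the adjoint linear maps. For a subrepresentation $U$ of $M$, $U^*=(U^*_q)_{q\in Q_0}$ denotes the collection of annihilators $U_q^*=\{f\in M_q^*\mid f(m)=0\text{ for all }m\in U_q\}$. An ordered basis of $M$ is a linearly ordered set $\mathcal B\subset\bigoplus_qM_q$ such that $\mathcal B_q=\mathcal B\cap M_q$ is a basis of $M_q$ for all $q$. The dual basis $\mathcal B^*$ of $M^*$ consists of the functionals $f_b$, $b\in\mathcal B$, with $f_b(b')=\delta_{b,b'}$, and is endowed with the inverse of the order of $\mathcal B$. For $\beta\subset\mathcal B$, put $\beta^*=\{f\in\mathcal B^*\mid f(b)=0\text{ for all }b\in\beta\}=\{f_b\mid b\notin\beta\}$. $\mathrm{Gr}_e(M)$ is the projective variety of subrepresentations of $M$ of dimension vector $e$. A subset $\beta\subset\mathcal B$ has type $e$ if $\#(\beta\cap\mathcal B_q)=e_q$ for all $q$; the Schubert cell $C^M_\beta\subset\mathrm{Gr}_e(M)$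 is the locally closed subset of those $U$ such that each $U_q$ has a basis $\{b+\sum_{b'\in\mathcal B_q\setminus\beta,\,b'<b}w_{b',b}b'\mid b\in\beta\cap\mathcal B_q\}$ with $w_{b',b}\in\mathbb C$; analogously for $M^*$ with $\mathcal B^*$. *)

theory Defs
  imports
    "Graph_Theory.Graph_Theory"
    "HOL-Analysis.Abstract_Topology"
    "HOL-Library.Function_Algebras"
    "Jordan_Normal_Form.Determinant"
begin

section \<open>Quiver representations\<close>

text \<open>
  All spaces \<open>M\<^sub>q\<close> live in one ambient type, as an internal direct sum: \<open>rep_space M q\<close> is
  the summand \<open>M\<^sub>q\<close> of \<open>\<Oplus>\<^sub>q M\<^sub>q\<close>. Only the restriction of \<open>rep_map M a\<close> to the space at the tail of
  \<open>a\<close> matters. Neither the quiver nor the spaces are required to be finite.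
\<close>

record ('q, 'a, 'v) quiver_rep =
  quiver :: "('q, 'a) pre_digraph"
  rep_scale :: "complex \<Rightarrow> 'v \<Rightarrow> 'v"
  rep_space :: "'q \<Rightarrow> 'v set"
  rep_map :: "'a \<Rightarrow> 'v \<Rightarrow> 'v"

definition is_rep :: "('q, 'a, 'v::ab_group_add) quiver_rep \<Rightarrow> bool" where
  "is_rep M \<longleftrightarrow>
     wf_digraph (quiver M) \<and>
     vector_space (rep_scale M) \<and>
     (\<forall>q\<in>verts (quiver M). Modules.module.subspace (rep_scale M) (rep_space M q)) \<and>
     (\<forall>q\<in>verts (quiver M).
        rep_space M q \<inter> Modules.module.span (rep_scale M) (\<Union>p\<in>verts (quiver M) - {q}. rep_space M p) = {0}) \<and>
     (\<forall>a\<in>arcs (quiver M). \<forall>x\<in>rep_space M (tail (quiver M) a).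
        rep_map M a x \<in> rep_space M (head (quiver M) a) \<and>
        (\<forall>y\<in>rep_space M (tail (quiver M) a). rep_map M a (x + y) = rep_map M a x + rep_map M a y) \<and>
        (\<forall>c. rep_map M a (rep_scale M c x) = rep_scale M c (rep_map M a x)))"

definition finite_dimensional_rep :: "('q, 'a, 'v::ab_group_add) quiver_rep \<Rightarrow> bool" where
  "finite_dimensional_rep M \<longleftrightarrow>
     (\<exists>S. finite S \<and> (\<Union>q\<in>verts (quiver M). rep_space M q) \<subseteq> Modules.module.span (rep_scale M) S)"

definition dimension_vector :: "('q, 'a, 'v::ab_group_add) quiver_rep \<Rightarrow> 'q \<Rightarrow> nat" where
  "dimension_vector M q = vector_space.dim (rep_scale M) (rep_space M q)"

definition is_basis_of :: "(complex \<Rightarrow> 'v \<Rightarrow> 'v) \<Rightarrow> 'v::ab_group_add set \<Rightarrow> 'v set \<Rightarrow> bool" where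
  "is_basis_of s A S \<longleftrightarrow> \<not> Modules.module.dependent s A \<and> Modules.module.span s A = S"

text \<open>A subrepresentation is a family of subspaces; as an extensional function on the vertex set
  it is determined by its values at the vertices.\<close>

definition subreps :: "('q, 'a, 'v::ab_group_add) quiver_rep \<Rightarrow> ('q \<Rightarrow> 'v set) set" where
  "subreps M =
     {U \<in> (\<Pi>\<^sub>E q\<in>verts (quiver M). {W. W \<subseteq> rep_space M q \<and> Modules.module.subspace (rep_scale M) W}).
        \<forall>a\<in>arcs (quiver M). rep_map M a ` U (tail (quiver M) a) \<subseteq> U (head (quiver M) a)}"

definition quiver_Gr :: "('q, 'a, 'v::ab_group_add) quiver_rep \<Rightarrow> ('q \<Rightarrow> nat) \<Rightarrow> ('q \<Rightarrow> 'v set) set" where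
  "quiver_Gr M e =
     {U \<in> subreps M. \<forall>q\<in>verts (quiver M). vector_space.dim (rep_scale M) (U q) = e q}"


section \<open>Duality\<close>

text \<open>Functionals on \<open>M\<^sub>q\<close> are represented by their extension by \<open>0\<close> to the ambient type. This makes
  the dual spaces an internal direct sum of subspaces of the function space again.\<close>

definition dual_space :: "('q, 'a, 'v::ab_group_add) quiver_rep \<Rightarrow> 'q \<Rightarrow> ('v \<Rightarrow> complex) set" where
  "dual_space M q =
     {f. (\<forall>x\<in>rep_space M q. \<forall>y\<in>rep_space M q. f (x + y) = f x + f y) \<and>
         (\<forall>c. \<forall>x\<in>rep_space M q. f (rep_scale M c x) = c * f x) \<and>
         (\<forall>x. x \<notin> rep_space M q \<longrightarrow> f x = 0)}"

definition opposite_quiver :: "('q, 'a) pre_digraph \<Rightarrow> ('q, 'a) pre_digraph" where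
  "opposite_quiver Q = \<lparr>verts = verts Q, arcs = arcs Q, tail = head Q, head = tail Q\<rparr>"

definition dual_rep :: "('q, 'a, 'v::ab_group_add) quiver_rep \<Rightarrow> ('q, 'a, 'v \<Rightarrow> complex) quiver_rep" where
  "dual_rep M =
     \<lparr>quiver = opposite_quiver (quiver M),
      rep_scale = (\<lambda>c f x. c * f x),
      rep_space = dual_space M,
      rep_map = (\<lambda>a f x. if x \<in> rep_space M (tail (quiver M) a) then f (rep_map M a x) else 0)\<rparr>"

definition dual_subrep ::
  "('q, 'a, 'v::ab_group_add) quiver_rep \<Rightarrow> ('q \<Rightarrow> 'v set) \<Rightarrow> 'q \<Rightarrow> ('v \<Rightarrow> complex) set" where
  "dual_subrep M U = (\<lambda>q\<in>verts (quiver M). {f \<in> dual_space M q. \<forall>m\<in>U q. f m = 0})"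


section \<open>Ordered bases and Schubert cells\<close>

text \<open>The elements of a basis are homogeneous; \<open>r\<close> is the reflexive order relation
  (\<open>(b', b) \<in> r\<close> means \<open>b' \<le> b\<close>).\<close>

definition ordered_basis ::
  "('q, 'a, 'v::ab_group_add) quiver_rep \<Rightarrow> 'v set \<Rightarrow> ('v \<times> 'v) set \<Rightarrow> bool" where
  "ordered_basis M B r \<longleftrightarrow>
     B \<subseteq> (\<Union>q\<in>verts (quiver M). rep_space M q) \<and>
     (\<forall>q\<in>verts (quiver M). is_basis_of (rep_scale M) (B \<inter> rep_space M q) (rep_space M q)) \<and>
     linear_order_on B r"

definition dual_functional ::
  "('q, 'a, 'v::ab_group_add) quiver_rep \<Rightarrow> 'v set \<Rightarrow> 'v \<Rightarrow> 'v \<Rightarrow> complex" where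
  "dual_functional M B b =
     (THE f. f \<in> (\<Union>q\<in>verts (quiver M). dual_space M q) \<and>
             (\<forall>b'\<in>B. f b' = (if b' = b then 1 else 0)))"

definition dual_basis ::
  "('q, 'a, 'v::ab_group_add) quiver_rep \<Rightarrow> 'v set \<Rightarrow> ('v \<Rightarrow> complex) set" where
  "dual_basis M B = dual_functional M B ` B"

definition dual_order ::
  "('q, 'a, 'v::ab_group_add) quiver_rep \<Rightarrow> 'v set \<Rightarrow> ('v \<times> 'v) set
     \<Rightarrow> (('v \<Rightarrow> complex) \<times> ('v \<Rightarrow> complex)) set" where
  "dual_order M B r = {(dual_functional M B b, dual_functional M B b') | b b'. (b', b) \<in> r}"

definition dual_subset ::
  "('q, 'a, 'v::ab_group_add) quiver_rep \<Rightarrow> 'v set \<Rightarrow> 'v set \<Rightarrow> ('v \<Rightarrow> complex) set" where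
  "dual_subset M B \<beta> = {f \<in> dual_basis M B. \<forall>b\<in>\<beta>. f b = 0}"

definition has_type ::
  "('q, 'a, 'v::ab_group_add) quiver_rep \<Rightarrow> 'v set \<Rightarrow> ('q \<Rightarrow> nat) \<Rightarrow> bool" where
  "has_type M \<beta> e \<longleftrightarrow> (\<forall>q\<in>verts (quiver M). card (\<beta> \<inter> rep_space M q) = e q)"

definition schubert_cell ::
  "('q, 'a, 'v::ab_group_add) quiver_rep \<Rightarrow> 'v set \<Rightarrow> ('v \<times> 'v) set \<Rightarrow> ('q \<Rightarrow> nat) \<Rightarrow> 'v set
     \<Rightarrow> ('q \<Rightarrow> 'v set) set" where
  "schubert_cell M B r e \<beta> =
     {U \<in> quiver_Gr M e. \<forall>q\<in>verts (quiver M). \<exists>w.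
        is_basis_of (rep_scale M)
          ((\<lambda>b. b + (\<Sum>b' | b' \<in> B \<inter> rep_space M q - \<beta> \<and> (b', b) \<in> r \<and> b' \<noteq> b. rep_scale M (w b' b) b'))
             ` (\<beta> \<inter> rep_space M q))
          (U q)}"


section \<open>Quasi-projective varieties\<close>

text \<open>
  A subset \<open>X\<close> of a product \<open>\<Prod>\<^sub>i \<P>(J\<^sub>i)\<close> of complex projective spaces is given by a set of points
  together with a map \<open>hc\<close> that assigns to each point the set of its multihomogeneous coordinate
  vectors \<open>x\<close>, where \<open>x i j\<close> is the \<open>j\<close>-th homogeneous coordinate in the \<open>i\<close>-th factor. As usual, the
  Zariski topology and the regular functions of \<open>X\<close> are defined by multihomogeneous polynomials.
\<close>

inductive multihomogeneous :: "('i \<Rightarrow> nat) \<Rightarrow> (('i \<Rightarrow> 'j \<Rightarrow> complex) \<Rightarrow> complex) \<Rightarrow> bool" where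
  const: "multihomogeneous (\<lambda>_. 0) (\<lambda>_. c)"
| coord: "multihomogeneous (\<lambda>k. if k = i then 1 else 0) (\<lambda>x. x i j)"
| add: "multihomogeneous d P \<Longrightarrow> multihomogeneous d R \<Longrightarrow> multihomogeneous d (\<lambda>x. P x + R x)"
| mult: "multihomogeneous d P \<Longrightarrow> multihomogeneous d' R \<Longrightarrow>
           multihomogeneous (\<lambda>k. d k + d' k) (\<lambda>x. P x * R x)"

definition zariski :: "('p \<Rightarrow> ('i \<Rightarrow> 'j \<Rightarrow> complex) set) \<Rightarrow> 'p set \<Rightarrow> 'p topology" where
  "zariski hc X =
     topology_generated_by {{u \<in> X. \<forall>x\<in>hc u. P x \<noteq> 0} | P. \<exists>d. multihomogeneous d P}"

definition regular_on ::
  "('p \<Rightarrow> ('i \<Rightarrow> 'j \<Rightarrow> complex) set) \<Rightarrow> 'p set \<Rightarrow> 'p set \<Rightarrow> ('p \<Rightarrow> complex) \<Rightarrow> bool" where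
  "regular_on hc X W f \<longleftrightarrow>
     openin (zariski hc X) W \<and>
     (\<forall>u\<in>W. \<exists>W' d P R.
        openin (zariski hc X) W' \<and> u \<in> W' \<and> W' \<subseteq> W \<and>
        multihomogeneous d P \<and> multihomogeneous d R \<and>
        (\<forall>v\<in>W'. \<forall>x\<in>hc v. R x \<noteq> 0 \<and> f v = P x / R x))"

definition variety_morphism ::
  "('p \<Rightarrow> ('i \<Rightarrow> 'j \<Rightarrow> complex) set) \<Rightarrow> 'p set \<Rightarrow> ('r \<Rightarrow> ('k \<Rightarrow> 'l \<Rightarrow> complex) set) \<Rightarrow> 'r set
     \<Rightarrow> ('p \<Rightarrow> 'r) \<Rightarrow> bool" where
  "variety_morphism hcX X hcY Y F \<longleftrightarrow>
     continuous_map (zariski hcX X) (zariski hcY Y) F \<and>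
     (\<forall>W f. regular_on hcY Y W f \<longrightarrow> regular_on hcX X {u \<in> X. F u \<in> W} (\<lambda>u. f (F u)))"

definition variety_isomorphism ::
  "('p \<Rightarrow> ('i \<Rightarrow> 'j \<Rightarrow> complex) set) \<Rightarrow> 'p set \<Rightarrow> ('r \<Rightarrow> ('k \<Rightarrow> 'l \<Rightarrow> complex) set) \<Rightarrow> 'r set
     \<Rightarrow> ('p \<Rightarrow> 'r) \<Rightarrow> bool" where
  "variety_isomorphism hcX X hcY Y F \<longleftrightarrow>
     variety_morphism hcX X hcY Y F \<and>
     (\<exists>G. variety_morphism hcY Y hcX X G \<and> (\<forall>u\<in>X. G (F u) = u) \<and> (\<forall>v\<in>Y. F (G v) = v))"

text \<open>
  The Pluecker embedding of quiver Grassmannians into the product of the projective spaces of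
  \<open>\<Lambda>\<^bsup>e\<^sub>q\<^esup> M\<^sub>q\<close>. The dual of the exterior power \<open>\<Lambda>\<^bsup>k\<^esup> V\<close> is spanned by the forms
  \<open>f\<^sub>1 \<and> \<dots> \<and> f\<^sub>k\<close>, which take the value \<open>det (f\<^sub>i u\<^sub>j)\<close> at \<open>u\<^sub>1 \<and> \<dots> \<and> u\<^sub>k\<close>; so the lists of functionals of
  length \<open>k\<close> index a basis-free system of homogeneous coordinates. Coordinates with an index of any
  other kind are set to \<open>0\<close>. The coordinate vectors of \<open>U\<close> come from all choices of bases of the \<open>U\<^sub>q\<close>.
\<close>

definition plucker_vector ::
  "('q, 'a, 'v::ab_group_add) quiver_rep \<Rightarrow> ('q \<Rightarrow> 'v list) \<Rightarrow> 'q \<Rightarrow> ('v \<Rightarrow> complex) list \<Rightarrow> complex" where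
  "plucker_vector M us q fs =
     (if q \<in> verts (quiver M) \<and> set fs \<subseteq> dual_space M q \<and> length fs = length (us q)
      then det (mat (length fs) (length fs) (\<lambda>(i, j). (fs ! i) (us q ! j)))
      else 0)"

definition plucker ::
  "('q, 'a, 'v::ab_group_add) quiver_rep \<Rightarrow> ('q \<Rightarrow> 'v set)
     \<Rightarrow> ('q \<Rightarrow> ('v \<Rightarrow> complex) list \<Rightarrow> complex) set" where
  "plucker M U =
     {plucker_vector M us | us. \<forall>q\<in>verts (quiver M).
        distinct (us q) \<and> is_basis_of (rep_scale M) (set (us q)) (U q)}"

end

theory Submission
  imports Defs
begin

text \<open>
  Let \<open>b\<close> be a basis of \<open>M\<^sub>q\<close>, \<open>u\<close> a basis of \<open>U\<^sub>q\<close>, \<open>f\<close> a basis of its annihilator and \<open>m\<close> a list of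
  vectors of the length of \<open>f\<close>. Up to a nonzero factor independent of \<open>m\<close>, the minor
  \<open>det (f\<^sub>i m\<^sub>j)\<close> is the determinant of the vectors \<open>u, m\<close> in the coordinates of \<open>b\<close>. By Laplace expansion
  along the columns \<open>m\<close> the latter is a linear form in the Pluecker coordinates of \<open>U\<^sub>q\<close> whose
  coefficients do not depend on \<open>U\<close>. Hence passing to annihilators is given, factor by factor, by linear
  forms in homogeneous coordinates, and so is the inverse map because the pairing of \<open>M\<^sub>q\<close> and \<open>M\<^sub>q\<^sup>*\<close>
  is symmetric in its two arguments. For Schubert cells, an echelon basis
  \<open>b\<^sub>i + \<Sum>\<^sub>j w\<^sub>j\<^sub>i b\<^sub>j\<close> of \<open>U\<^sub>q\<close> yields the echelon basis \<open>f\<^sub>j - \<Sum>\<^sub>i w\<^sub>j\<^sub>i f\<^sub>i\<close> of the annihilator.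
\<close>

section \<open>Linear algebra of a perfect pairing\<close>

text \<open>A vector of \<open>span T\<close> outside \<open>span B\<close> could be added to
  \<open>B\<close>, giving an independent subset of \<open>span T\<close> with more than
  \<open>card T\<close> elements.\<close>

lemma (in vector_space) span_eq_of_card_le:
  assumes "independent B" "B \<subseteq> span T" "finite T" "card T \<le> card B"
  shows "span B = span T"
proof
  show "span B \<subseteq> span T"
    using assms(2) by (metis span_mono span_span)
  show "span T \<subseteq> span B"
  proof (rule ccontr)
    assume "\<not> span T \<subseteq> span B"
    then obtain x where x: "x \<in> span T" "x \<notin> span B" by blast
    have B: "finite B" using independent_span_bound assms by blast
    have "independent (insert x B)"
      using x(2) assms(1) by (simp add: independent_insertI)
    moreover have "insert x B \<subseteq> span T" using x assms(2) by auto
    ultimately have "card (insert x B) \<le> card T"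
      using independent_span_bound[OF assms(3)] by blast
    moreover have "x \<notin> B" using x(2) span_base by blast
    ultimately show False using B assms(4) by simp
  qed
qed

text \<open>Linearity is assumed on the subspace \<open>S\<close> only: functionals on one summand
  are extended by 0, and this extension is in general not linear on the ambient type.\<close>

lemma (in vector_space) functional_linear_combination:
  assumes S: "subspace S"
    and add: "\<And>x y. x \<in> S \<Longrightarrow> y \<in> S \<Longrightarrow> f (x + y) = f x + f y"
    and scale: "\<And>c x. x \<in> S \<Longrightarrow> f (scale c x) = c * f x"
    and "finite A" "\<And>a. a \<in> A \<Longrightarrow> x a \<in> S"
  shows "f (\<Sum>a\<in>A. scale (c a) (x a)) = (\<Sum>a\<in>A. c a * f (x a))"
  using assms(4,5)
proof (induction A)
  case empty
  show ?case using scale[of 0 0] subspace_0[OF S] by simp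
next
  case (insert a A)
  have "(\<Sum>a\<in>A. scale (c a) (x a)) \<in> S"
    using insert.prems by (intro subspace_sum[OF S] subspace_scale[OF S]) simp
  then show ?case
    using insert by (simp add: add scale subspace_scale[OF S])
qed

text \<open>The pairing is a parameter, so that flipping its arguments also gives annihilators in
  \<open>X\<close> of subsets of \<open>Y\<close>.\<close>

definition annihilator :: "('w \<Rightarrow> 'v \<Rightarrow> complex) \<Rightarrow> 'w set \<Rightarrow> 'v set \<Rightarrow> 'w set" where
  "annihilator p Y U = {y \<in> Y. \<forall>x\<in>U. p y x = 0}"

definition pairing_mat :: "('w \<Rightarrow> 'v \<Rightarrow> complex) \<Rightarrow> 'w list \<Rightarrow> 'v list \<Rightarrow> complex mat" where
  "pairing_mat p fs us = mat (length fs) (length us) (\<lambda>(i, j). p (fs ! i) (us ! j))"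

lemma pairing_mat_dim [simp]:
  "dim_row (pairing_mat p fs us) = length fs" "dim_col (pairing_mat p fs us) = length us"
  by (simp_all add: pairing_mat_def)

text \<open>A perfect pairing of two finite-dimensional subspaces, witnessed by spanning families
  that are dual to each other; duality makes both families bases. The axioms are symmetric in the
  two sides, so each result has a mirror image obtained through \<open>swap\<close>.\<close>

locale dual_pair = V: vector_space sV + W: vector_space sW
  for sV :: "complex \<Rightarrow> 'v::ab_group_add \<Rightarrow> 'v" and sW :: "complex \<Rightarrow> 'w::ab_group_add \<Rightarrow> 'w" +
  fixes X :: "'v set" and Y :: "'w set" and p :: "'w \<Rightarrow> 'v \<Rightarrow> complex"
    and I :: "'i set" and b :: "'i \<Rightarrow> 'v" and f :: "'i \<Rightarrow> 'w"
  assumes fin: "finite I"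
    and span_b: "V.span (b ` I) = X" and span_f: "W.span (f ` I) = Y"
    and add_right: "\<And>y x x'. y \<in> Y \<Longrightarrow> x \<in> X \<Longrightarrow> x' \<in> X \<Longrightarrow> p y (x + x') = p y x + p y x'"
    and scale_right: "\<And>y x c. y \<in> Y \<Longrightarrow> x \<in> X \<Longrightarrow> p y (sV c x) = c * p y x"
    and add_left: "\<And>y y' x. y \<in> Y \<Longrightarrow> y' \<in> Y \<Longrightarrow> x \<in> X \<Longrightarrow> p (y + y') x = p y x + p y' x"
    and scale_left: "\<And>y x c. y \<in> Y \<Longrightarrow> x \<in> X \<Longrightarrow> p (sW c y) x = c * p y x"
    and dual: "\<And>i j. i \<in> I \<Longrightarrow> j \<in> I \<Longrightarrow> p (f i) (b j) = (if i = j then 1 else 0)"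
begin

lemma swap: "dual_pair sW sV Y X (\<lambda>x y. p y x) I f b"
  by unfold_locales
    (use fin span_b span_f add_right scale_right add_left scale_left dual in auto)

lemma subspace_X: "V.subspace X"
  using V.subspace_span span_b by metis

section \<open>Coordinates with respect to dual families\<close>

lemma b_in: "i \<in> I \<Longrightarrow> b i \<in> X"
  using span_b V.span_base by blast

lemma f_in: "i \<in> I \<Longrightarrow> f i \<in> Y"
  using span_f W.span_base by blast

lemma zero_right: "y \<in> Y \<Longrightarrow> p y 0 = 0"
  using scale_right[of y 0 0] V.subspace_0[OF subspace_X] by simp

lemma linear_combination_right:
  assumes "y \<in> Y" "finite S" "\<And>s. s \<in> S \<Longrightarrow> x s \<in> X"
  shows "p y (\<Sum>s\<in>S. sV (c s) (x s)) = (\<Sum>s\<in>S. c s * p y (x s))"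
  by (rule V.functional_linear_combination[OF subspace_X])
    (simp_all add: assms add_right scale_right)

lemma inj_b: "inj_on b I"
  by (rule inj_onI) (metis dual zero_neq_one)

lemma card_b: "card (b ` J) = card J" if "J \<subseteq> I"
  using card_image inj_on_subset[OF inj_b that] by blast

lemma coefficient:
  assumes "J \<subseteq> I" "i \<in> I"
  shows "p (f i) (\<Sum>j\<in>J. sV (c j) (b j)) = (if i \<in> J then c i else 0)"
proof -
  have J: "finite J" using assms fin finite_subset by blast
  have "p (f i) (\<Sum>j\<in>J. sV (c j) (b j)) = (\<Sum>j\<in>J. c j * p (f i) (b j))"
    using assms J by (intro linear_combination_right) (auto intro: f_in b_in)
  also have "\<dots> = (\<Sum>j\<in>J. if j = i then c j else 0)"
    using assms by (intro sum.cong) (auto simp: dual)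
  finally show ?thesis using J by simp
qed

text \<open>Since \<open>b\<close> is injective, coefficients can be indexed by \<open>J\<close>
  instead of by the vectors themselves.\<close>

lemma span_b_eq: "V.span (b ` J) = range (\<lambda>u. \<Sum>j\<in>J. sV (u j) (b j))" if J: "J \<subseteq> I"
proof -
  have inj: "inj_on b J" using inj_on_subset[OF inj_b J] .
  have "finite J" using J fin finite_subset by blast
  then have "V.span (b ` J) = range (\<lambda>u. \<Sum>v\<in>b ` J. sV (u v) v)"
    by (simp add: V.span_finite)
  also have "\<dots> = range (\<lambda>u. \<Sum>j\<in>J. sV (u (b j)) (b j))"
    by (simp add: sum.reindex[OF inj])
  also have "\<dots> = range (\<lambda>u. \<Sum>j\<in>J. sV (u j) (b j))"
  proof (intro Set.set_eqI iffI)
    fix x assume "x \<in> range (\<lambda>u. \<Sum>j\<in>J. sV (u j) (b j))"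
    then obtain u where "x = (\<Sum>j\<in>J. sV (u j) (b j))" by blast
    also have "\<dots> = (\<Sum>j\<in>J. sV ((u \<circ> inv_into J b) (b j)) (b j))"
      by (intro sum.cong) (simp_all add: inv_into_f_f[OF inj])
    finally show "x \<in> range (\<lambda>u. \<Sum>j\<in>J. sV (u (b j)) (b j))" by blast
  next
    fix x assume "x \<in> range (\<lambda>u. \<Sum>j\<in>J. sV (u (b j)) (b j))"
    then obtain u where "x = (\<Sum>j\<in>J. sV (u (b j)) (b j))" by blast
    then show "x \<in> range (\<lambda>u. \<Sum>j\<in>J. sV (u j) (b j))"
      by (intro range_eqI[of _ _ "\<lambda>j. u (b j)"])
  qed
  finally show ?thesis .
qed

lemma combination_in_span: "(\<Sum>j\<in>J. sV (u j) (b j)) \<in> V.span (b ` J)"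
  by (intro V.span_sum V.span_scale V.span_base imageI)

lemma in_span_bE:
  assumes "x \<in> V.span (b ` J)" "J \<subseteq> I"
  obtains u where "x = (\<Sum>j\<in>J. sV (u j) (b j))"
  using assms(1) unfolding span_b_eq[OF assms(2)] by blast

text \<open>By duality, pairing with \<open>f i\<close> reads off the coefficient at
  \<open>b i\<close>.\<close>

lemma expand: "x = (\<Sum>i\<in>I. sV (p (f i) x) (b i))" if "x \<in> X"
proof -
  have "x \<in> V.span (b ` I)" using that span_b by simp
  then obtain u where u: "x = (\<Sum>j\<in>I. sV (u j) (b j))" by (rule in_span_bE) simp
  have "p (f i) x = u i" if "i \<in> I" for i
    using that u coefficient[OF order_refl that] by simp
  then have "(\<Sum>i\<in>I. sV (p (f i) x) (b i)) = (\<Sum>j\<in>I. sV (u j) (b j))"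
    by simp
  with u show ?thesis by simp
qed

lemma span_b_iff: "x \<in> V.span (b ` J) \<longleftrightarrow> x \<in> X \<and> (\<forall>i\<in>I - J. p (f i) x = 0)" if J: "J \<subseteq> I"
proof
  assume x: "x \<in> V.span (b ` J)"
  then have "x \<in> X" using V.span_mono[of "b ` J" "b ` I"] J span_b by blast
  moreover obtain u where "x = (\<Sum>j\<in>J. sV (u j) (b j))"
    by (rule in_span_bE[OF x J])
  ultimately show "x \<in> X \<and> (\<forall>i\<in>I - J. p (f i) x = 0)"
    using coefficient[OF J] by auto
next
  assume x: "x \<in> X \<and> (\<forall>i\<in>I - J. p (f i) x = 0)"
  have "x = (\<Sum>i\<in>I. sV (p (f i) x) (b i))" using expand x by blast
  also have "\<dots> = (\<Sum>i\<in>J. sV (p (f i) x) (b i))"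
    using x J fin by (intro sum.mono_neutral_right) auto
  finally show "x \<in> V.span (b ` J)" using combination_in_span by metis
qed

text \<open>Pairing a linear relation with \<open>f' i\<close> isolates one coefficient. An
  independent family with as many members as \<open>b\<close> then spans \<open>X\<close> by
  cardinality.\<close>

lemma independent_dual_family:
  assumes b': "\<And>i. i \<in> I \<Longrightarrow> b' i \<in> X" and f': "\<And>i. i \<in> I \<Longrightarrow> f' i \<in> Y"
    and d: "\<And>i j. i \<in> I \<Longrightarrow> j \<in> I \<Longrightarrow> p (f' i) (b' j) = (if i = j then 1 else 0)"
  shows "inj_on b' I" "V.independent (b' ` I)" "V.span (b' ` I) = X"
proof -
  show inj: "inj_on b' I"
    by (rule inj_onI) (metis d zero_neq_one)
  show ind: "V.independent (b' ` I)"
  proof (rule V.independent_if_scalars_zero)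
    show "finite (b' ` I)" using fin by simp
    fix c x assume z: "(\<Sum>x\<in>b' ` I. sV (c x) x) = 0" and "x \<in> b' ` I"
    then obtain i where i: "i \<in> I" "x = b' i" by blast
    have "0 = p (f' i) (\<Sum>j\<in>I. sV (c (b' j)) (b' j))"
      using z by (simp add: sum.reindex[OF inj] zero_right f' i)
    also have "\<dots> = (\<Sum>j\<in>I. c (b' j) * p (f' i) (b' j))"
      using fin b' f' i by (intro linear_combination_right) auto
    also have "\<dots> = (\<Sum>j\<in>I. if j = i then c (b' j) else 0)"
      using i by (intro sum.cong) (auto simp: d)
    finally show "c x = 0" using fin i by simp
  qed
  show "V.span (b' ` I) = X"
    using V.span_eq_of_card_le[OF ind, of "b ` I"] fin b' span_b card_image[OF inj] card_image[OF inj_b]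
    by auto
qed

text \<open>To change bases it suffices to check duality: spanning on the \<open>X\<close> side is
  the previous lemma, and on the \<open>Y\<close> side its mirror image.\<close>

lemma dual_families:
  assumes b': "\<And>i. i \<in> I \<Longrightarrow> b' i \<in> X" and f': "\<And>i. i \<in> I \<Longrightarrow> f' i \<in> Y"
    and d: "\<And>i j. i \<in> I \<Longrightarrow> j \<in> I \<Longrightarrow> p (f' i) (b' j) = (if i = j then 1 else 0)"
  shows "dual_pair sV sW X Y p I b' f'"
proof -
  have "W.span (f' ` I) = Y"
    using d by (intro dual_pair.independent_dual_family(3)[OF swap f' b']) auto
  then show ?thesis
    using independent_dual_family(3)[OF b' f' d] fin d
    by unfold_locales (simp_all add: add_right scale_right add_left scale_left)
qed

section \<open>Dimension and change of basis\<close>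

lemma independent_b: "V.independent (b ` J)" if "J \<subseteq> I"
  by (rule V.independent_mono[OF independent_dual_family(2)[of b f]])
    (use that in \<open>auto intro: b_in f_in simp: dual\<close>)

lemma dim_X: "V.dim X = card I"
  using V.dim_span_eq_card_independent[OF independent_b[OF order_refl]] span_b card_b[OF order_refl]
  by simp

lemma finite_independent: "finite C" if "V.independent C" "C \<subseteq> X"
  using V.independent_span_bound[of "b ` I" C] fin span_b that by simp

text \<open>Every basis of \<open>X\<close> has a dual family in \<open>Y\<close>, because its
  coordinate functionals are represented by elements of \<open>Y\<close>.\<close>

lemma rebase:
  assumes C: "V.independent C" "V.span C = X"
  obtains g where "dual_pair sV sW X Y p C (\<lambda>c. c) g"
proof -
  have CX: "C \<subseteq> X" using C V.span_superset by blast
  have finC: "finite C" using finite_independent C CX by blast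
  have card: "card C = card I"
    using V.dim_span_eq_card_independent[OF C(1)] C(2) dim_X by simp
  obtain h where h: "bij_betw h I C"
    using card finC fin finite_same_card_bij by metis
  let ?R = "\<lambda>c x. V.representation C x c"
  \<comment> \<open>The coordinate functional of \<open>c\<close> takes the value
    \<open>?R c (b i)\<close> at \<open>b i\<close>, which is therefore its coefficient at
    \<open>f i\<close>.\<close>
  define g where "g c = (\<Sum>i\<in>I. sW (?R c (b i)) (f i))" for c
  have gY: "g c \<in> Y" for c
    unfolding g_def by (intro W.subspace_sum W.subspace_scale dual_pair.subspace_X[OF swap] f_in)
  have g: "p (g c) x = ?R c x" if x: "x \<in> X" for c x
  proof -
    have "p (g c) x = (\<Sum>i\<in>I. ?R c (b i) * p (f i) x)"
      unfolding g_def using fin x f_in by (intro dual_pair.linear_combination_right[OF swap]) auto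
    also have "\<dots> = ?R c (\<Sum>i\<in>I. sV (p (f i) x) (b i))"
    proof -
      have b: "b i \<in> V.span C" if "i \<in> I" for i using that b_in C(2) by simp
      then show ?thesis
        by (subst V.representation_sum[OF C(1)])
          (auto simp: V.span_scale V.representation_scale[OF C(1)] mult.commute intro!: sum.cong)
    qed
    also have "\<dots> = ?R c x" using expand[OF x] by simp
    finally show ?thesis .
  qed
  have hC: "i \<in> I \<Longrightarrow> h i \<in> C" for i using h by (auto simp: bij_betw_def)
  \<comment> \<open>\<open>dual_families\<close> keeps the index set, so \<open>C\<close> is first
    enumerated by \<open>h\<close> over \<open>I\<close> and indexed by itself only
    afterwards.\<close>
  have "dual_pair sV sW X Y p I h (g \<circ> h)"
  proof (rule dual_families)
    show "p ((g \<circ> h) i) (h j) = (if i = j then 1 else 0)" if "i \<in> I" "j \<in> I" for i j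
      using that hC CX h by (auto simp: g V.representation_basis[OF C(1)] bij_betw_def inj_on_def subset_iff)
  qed (use hC CX gY in auto)
  then interpret h: dual_pair sV sW X Y p I h "g \<circ> h" .
  have "dual_pair sV sW X Y p C (\<lambda>c. c) g"
  proof
    show "W.span (g ` C) = Y"
      using h.span_f h by (metis bij_betw_imp_surj_on image_comp)
    show "p (g i) j = (if i = j then 1 else 0)" if "i \<in> C" "j \<in> C" for i j
      using that CX by (auto simp: g V.representation_basis[OF C(1)] subset_iff)
  qed (use finC C in \<open>simp_all add: add_right scale_right add_left scale_left\<close>)
  then show ?thesis by (rule that)
qed

lemma rebase_subspace:
  assumes U: "U \<subseteq> X" "V.subspace U" and C0: "V.independent C0" "V.span C0 = U"
  obtains C g where "C0 \<subseteq> C" "dual_pair sV sW X Y p C (\<lambda>c. c) g"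
proof -
  have "C0 \<subseteq> X" using C0 U V.span_superset by blast
  from V.maximal_independent_subset_extend[OF this C0(1)] obtain C
    where C: "C0 \<subseteq> C" "C \<subseteq> X" "V.independent C" "X \<subseteq> V.span C" by blast
  then have "V.span C = X"
    using V.span_minimal[OF _ subspace_X] by blast
  then show ?thesis by (rule rebase[OF C(3)]) (rule that[OF C(1)])
qed

text \<open>In dual coordinates, membership in the span of the complementary \<open>f i\<close>
  means that the coordinates \<open>p y (b i)\<close> with \<open>i\<close> in \<open>J\<close>
  vanish; by linearity this is vanishing on the whole span.\<close>

lemma annihilator_span_b:
  assumes J: "J \<subseteq> I"
  shows "annihilator p Y (V.span (b ` J)) = W.span (f ` (I - J))"
proof (rule Set.set_eqI)
  fix y
  have "y \<in> W.span (f ` (I - J)) \<longleftrightarrow> y \<in> Y \<and> (\<forall>i\<in>J. p y (b i) = 0)"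
    using dual_pair.span_b_iff[OF swap, of "I - J"] J by (simp add: double_diff)
  moreover have "(\<forall>x\<in>V.span (b ` J). p y x = 0) \<longleftrightarrow> (\<forall>i\<in>J. p y (b i) = 0)" if y: "y \<in> Y"
  proof (intro iffI ballI)
    fix x assume a: "\<forall>i\<in>J. p y (b i) = 0" and x: "x \<in> V.span (b ` J)"
    obtain u where "x = (\<Sum>j\<in>J. sV (u j) (b j))" by (rule in_span_bE[OF x J])
    moreover have "finite J" using J fin finite_subset by blast
    ultimately show "p y x = 0"
      using a y J by (simp add: linear_combination_right b_in subset_iff)
  qed (auto intro: V.span_base)
  ultimately show "y \<in> annihilator p Y (V.span (b ` J)) \<longleftrightarrow> y \<in> W.span (f ` (I - J))"
    unfolding annihilator_def by blast
qed

section \<open>Dimension and biduality of annihilators\<close>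

lemma subspace_obtain:
  assumes U: "U \<subseteq> X" "V.subspace U"
  obtains C C0 g where "C0 \<subseteq> C" "V.independent C0" "V.span C0 = U"
    "dual_pair sV sW X Y p C (\<lambda>c. c) g"
proof -
  obtain C0 where C0: "C0 \<subseteq> U" "V.independent C0" "U \<subseteq> V.span C0"
    using V.basis_exists by metis
  then have s: "V.span C0 = U" using V.span_minimal[OF _ U(2)] by blast
  show ?thesis by (rule rebase_subspace[OF U C0(2) s], rule that[OF _ C0(2) s])
qed

lemma subspace_annihilator: "W.subspace (annihilator p Y U)" if "U \<subseteq> X"
proof -
  have "W.subspace Y" using dual_pair.subspace_X[OF swap] .
  then show ?thesis
    unfolding W.subspace_def annihilator_def using that dual_pair.zero_right[OF swap]
    by (auto simp: add_left scale_left subset_iff)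
qed

text \<open>In a basis adapted to \<open>U\<close>, the annihilator has as basis the dual vectors of
  the basis elements that do not belong to \<open>U\<close>'s part \<open>C0\<close>.\<close>

lemma dim_annihilator:
  assumes U: "U \<subseteq> X" "V.subspace U"
  shows "W.dim (annihilator p Y U) = card I - V.dim U"
proof -
  obtain C C0 g where C: "C0 \<subseteq> C" "V.independent C0" "V.span C0 = U"
    "dual_pair sV sW X Y p C (\<lambda>c. c) g" by (rule subspace_obtain[OF U])
  then interpret C: dual_pair sV sW X Y p C "\<lambda>c. c" g by simp
  have "annihilator p Y U = W.span (g ` (C - C0))"
    using C.annihilator_span_b[OF C(1)] C(3) by simp
  then have "W.dim (annihilator p Y U) = card (g ` (C - C0))"
    using dual_pair.independent_b[OF C.swap, of "C - C0"] W.dim_eq_card_independent by simp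
  also have "\<dots> = card C - card C0"
    using dual_pair.card_b[OF C.swap, of "C - C0"]
    by (simp add: card_Diff_subset finite_subset[OF C(1) C.fin] C(1))
  also have "card C0 = V.dim U" using V.dim_span_eq_card_independent[OF C(2)] C(3) by simp
  finally show ?thesis using C.dim_X dim_X by simp
qed

text \<open>In an adapted basis, taking annihilators passes to the complementary index set, and
  doing so twice returns to \<open>C0\<close>.\<close>

lemma annihilator_annihilator:
  assumes U: "U \<subseteq> X" "V.subspace U"
  shows "annihilator (\<lambda>x y. p y x) X (annihilator p Y U) = U"
proof -
  obtain C C0 g where C: "C0 \<subseteq> C" "V.independent C0" "V.span C0 = U"
    "dual_pair sV sW X Y p C (\<lambda>c. c) g" by (rule subspace_obtain[OF U])
  then interpret C: dual_pair sV sW X Y p C "\<lambda>c. c" g by simp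
  have "annihilator p Y U = W.span (g ` (C - C0))"
    using C.annihilator_span_b[OF C(1)] C(3) by simp
  then show ?thesis
    using dual_pair.annihilator_span_b[OF C.swap, of "C - C0"] C(1,3) by (simp add: double_diff)
qed

text \<open>Replacing \<open>b\<close> by the echelon vectors on \<open>J\<close> and
  \<open>f\<close> by the proposed ones outside \<open>J\<close> yields dual families again, so
  \<open>annihilator_span_b\<close> applies to them. The relation \<open>R\<close> is left
  arbitrary, which lets the same lemma serve an order and its inverse.\<close>

lemma echelon_annihilator:
  assumes J: "J \<subseteq> I"
    and U: "V.span ((\<lambda>i. b i + (\<Sum>j | j \<in> I - J \<and> R j i. sV (w j i) (b j))) ` J) = U"
  shows "is_basis_of sW ((\<lambda>i. f i + (\<Sum>j | j \<in> J \<and> R i j. sW (- w i j) (f j))) ` (I - J))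
           (annihilator p Y U)"
proof -
  define u where "u i = b i + (\<Sum>j | j \<in> I - J \<and> R j i. sV (w j i) (b j))" for i
  define g where "g i = f i + (\<Sum>j | j \<in> J \<and> R i j. sW (- w i j) (f j))" for i
  have finJ: "finite J" using J fin finite_subset by blast
  have JI: "i \<in> I" if "i \<in> J" for i using J that by blast
  define b' where "b' i = (if i \<in> J then u i else b i)" for i
  define f' where "f' i = (if i \<in> J then f i else g i)" for i
  have uX: "u i \<in> X" if "i \<in> J" for i
    unfolding u_def using that J b_in
    by (intro V.subspace_add[OF subspace_X] V.subspace_sum[OF subspace_X] V.subspace_scale[OF subspace_X]) auto
  have SY: "W.subspace Y" using dual_pair.subspace_X[OF swap] .
  have gY: "g i \<in> Y" if "i \<in> I" for i
    unfolding g_def using that J f_in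
    by (intro W.subspace_add[OF SY] W.subspace_sum[OF SY] W.subspace_scale[OF SY]) auto
  have pu: "p (f k) (u i) = (if k = i then 1 else if k \<in> I - J \<and> R k i then w k i else 0)"
    if "k \<in> I" "i \<in> J" for k i
  proof -
    have "p (f k) (u i) = p (f k) (b i) + p (f k) (\<Sum>j | j \<in> I - J \<and> R j i. sV (w j i) (b j))"
      unfolding u_def using that J
      by (intro add_right f_in b_in V.subspace_sum[OF subspace_X] V.subspace_scale[OF subspace_X]) auto
    then show ?thesis using that J by (auto simp: dual coefficient)
  qed
  have pg: "p (g i) x = p (f i) x + (\<Sum>j | j \<in> J \<and> R i j. - w i j * p (f j) x)"
    if "i \<in> I" "x \<in> X" for i x
  proof -
    have "p (g i) x = p (f i) x + p (\<Sum>j | j \<in> J \<and> R i j. sW (- w i j) (f j)) x"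
      unfolding g_def using that J
      by (intro add_left f_in W.subspace_sum[OF SY] W.subspace_scale[OF SY]) auto
    also have "p (\<Sum>j | j \<in> J \<and> R i j. sW (- w i j) (f j)) x = (\<Sum>j | j \<in> J \<and> R i j. - w i j * p (f j) x)"
      using that J finJ by (intro dual_pair.linear_combination_right[OF swap] f_in) auto
    finally show ?thesis .
  qed
  have "dual_pair sV sW X Y p I b' f'"
  proof (rule dual_families)
    fix i j assume ij: "i \<in> I" "j \<in> I"
    consider "i \<in> J" "j \<in> J" | "i \<in> J" "j \<notin> J" | "i \<notin> J" "j \<notin> J" | "i \<notin> J" "j \<in> J" by blast
    then show "p (f' i) (b' j) = (if i = j then 1 else 0)"
    proof cases
      case 3
      have "(\<Sum>k | k \<in> J \<and> R i k. - w i k * p (f k) (b j)) = 0"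
        using 3 ij by (intro sum.neutral) (auto simp: dual JI)
      then show ?thesis using 3 ij by (simp add: f'_def b'_def pg b_in dual)
    next
      case 4
      \<comment> \<open>The one case where the sign matters: \<open>f i\<close> pairs with
        \<open>u j\<close> to \<open>w i j\<close> if \<open>R i j\<close>, and this sum contributes
        the opposite value.\<close>
      have "(\<Sum>k | k \<in> J \<and> R i k. - w i k * p (f k) (u j)) = (\<Sum>k | k \<in> J \<and> R i k. if k = j then - w i k else 0)"
        using 4 ij by (intro sum.cong) (auto simp: pu JI)
      also have "\<dots> = (if R i j then - w i j else 0)" using 4 finJ by simp
      finally show ?thesis using 4 ij by (auto simp: f'_def b'_def pg pu uX)
    qed (use ij in \<open>auto simp: f'_def b'_def pu dual\<close>)
  qed (auto simp: b'_def f'_def uX b_in f_in gY)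
  then interpret D: dual_pair sV sW X Y p I b' f' .
  have "b' ` J = u ` J" "f' ` (I - J) = g ` (I - J)" by (auto simp: b'_def f'_def)
  moreover have "V.span (u ` J) = U" using U by (simp add: u_def)
  ultimately have "annihilator p Y U = W.span (g ` (I - J))" "W.independent (g ` (I - J))"
    using D.annihilator_span_b[OF J] dual_pair.independent_b[OF D.swap, of "I - J"] by simp_all
  then show ?thesis by (simp add: is_basis_of_def g_def)
qed

text \<open>Expanding each vector of \<open>us\<close> in the basis \<open>b\<close> inserts the
  identity between the two lists; \<open>cs\<close> fixes the order of the summation index.\<close>

lemma pairing_mat_mult:
  assumes cs: "distinct cs" "set cs = I"
    and "set fs \<subseteq> Y" "set us \<subseteq> X"
  shows "pairing_mat p fs us = pairing_mat p fs (map b cs) * pairing_mat p (map f cs) us"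
proof (rule eq_matI)
  fix i j assume "i < dim_row (pairing_mat p fs (map b cs) * pairing_mat p (map f cs) us)"
    "j < dim_col (pairing_mat p fs (map b cs) * pairing_mat p (map f cs) us)"
  then have ij: "i < length fs" "j < length us" by simp_all
  have x: "us ! j \<in> X" and y: "fs ! i \<in> Y" using ij assms(3,4) by auto
  have "p (fs ! i) (us ! j) = p (fs ! i) (\<Sum>c\<in>I. sV (p (f c) (us ! j)) (b c))"
    using expand[OF x] by simp
  also have "\<dots> = (\<Sum>c\<in>I. p (f c) (us ! j) * p (fs ! i) (b c))"
    using fin y b_in by (intro linear_combination_right) auto
  also have "\<dots> = (\<Sum>k<length cs. p (f (cs ! k)) (us ! j) * p (fs ! i) (b (cs ! k)))"
    using sum.reindex_bij_betw[OF bij_betw_nth[OF cs(1) refl cs(2)[symmetric]],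
      of "\<lambda>c. p (f c) (us ! j) * p (fs ! i) (b c)"] by simp
  finally show "pairing_mat p fs us $$ (i, j) = (pairing_mat p fs (map b cs) * pairing_mat p (map f cs) us) $$ (i, j)"
    using ij by (simp add: pairing_mat_def scalar_prod_def atLeast0LessThan mult.commute)
qed simp_all

lemma pairing_mat_dual:
  assumes "distinct cs" "set cs \<subseteq> I"
  shows "pairing_mat p (map f cs) (map b cs) = 1\<^sub>m (length cs)"
  using assms by (intro eq_matI) (auto simp: pairing_mat_def dual subset_iff nth_eq_iff_index_eq)

end

section \<open>Minors of a subspace and of its annihilator\<close>

lemma pairing_mat_append:
  "pairing_mat p (fs @ gs) (us @ vs) =
     four_block_mat (pairing_mat p fs us) (pairing_mat p fs vs) (pairing_mat p gs us) (pairing_mat p gs vs)"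
  by (rule eq_matI) (auto simp: pairing_mat_def nth_append)

lemma transpose_pairing_mat: "transpose_mat (pairing_mat p fs us) = pairing_mat (\<lambda>x y. p y x) us fs"
  by (rule eq_matI) (auto simp: pairing_mat_def)

lemma pairing_mat_cong:
  assumes "length fs = length fs'" "length us = length us'"
    and "\<And>i j. i < length fs \<Longrightarrow> j < length us \<Longrightarrow> p (fs ! i) (us ! j) = p' (fs' ! i) (us' ! j)"
  shows "pairing_mat p fs us = pairing_mat p' fs' us'"
  using assms by (intro eq_matI) (auto simp: pairing_mat_def)

text \<open>The matrix of functionals dual to \<open>us\<close>, followed by \<open>fs\<close>,
  against \<open>us @ ms\<close> is evaluated in two ways: it is block triangular with an identity
  block, and it factors through the fixed basis \<open>b\<close>.\<close>

lemma (in dual_pair) minors_annihilator: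
  assumes cs: "distinct cs" "set cs = I"
    and U: "U \<subseteq> X" "distinct us" "V.independent (set us)" "V.span (set us) = U"
    and fs: "distinct fs" "W.independent (set fs)" "W.span (set fs) = annihilator p Y U"
  shows "length us + length fs = length cs"
    and "\<exists>c. c \<noteq> 0 \<and> (\<forall>ms. set ms \<subseteq> X \<and> length ms = length fs \<longrightarrow>
           det (pairing_mat p fs ms) = c * det (pairing_mat p (map f cs) (us @ ms)))"
proof -
  have sU: "V.subspace U" using U(4) V.subspace_span by metis
  have usX: "set us \<subseteq> X" using U V.span_superset by blast
  have ann: "annihilator p Y U \<subseteq> Y" by (auto simp: annihilator_def)
  have fsY: "set fs \<subseteq> annihilator p Y U" using fs(3) W.span_superset by blast
  have "length us = V.dim U"
    using V.dim_span_eq_card_independent[OF U(3)] distinct_card[OF U(2)] U(4) by simp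
  moreover have "length fs = card I - V.dim U"
    using W.dim_span_eq_card_independent[OF fs(2)] distinct_card[OF fs(1)] fs(3)
      dim_annihilator[OF U(1) sU] by simp
  moreover have "card (set us) \<le> card I"
    using V.independent_span_bound[OF finite_imageI[OF fin] U(3), of b] usX span_b card_b[OF order_refl]
    by simp
  ultimately show len: "length us + length fs = length cs"
    using distinct_card[OF cs(1)] distinct_card[OF U(2)] cs(2) by simp
  obtain C g where C: "set us \<subseteq> C" "dual_pair sV sW X Y p C (\<lambda>c. c) g"
    by (rule rebase_subspace[OF U(1) sU U(3,4)])
  obtain D h where D: "set fs \<subseteq> D" "dual_pair sW sV Y X (\<lambda>x y. p y x) D (\<lambda>c. c) h"
    by (rule dual_pair.rebase_subspace[OF swap ann subspace_annihilator[OF U(1)] fs(2,3)])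
  interpret C: dual_pair sV sW X Y p C "\<lambda>c. c" g by fact
  interpret D: dual_pair sW sV Y X "\<lambda>x y. p y x" D "\<lambda>c. c" h by fact
  \<comment> \<open>The change of basis determinant depends on \<open>us\<close> and
    \<open>fs\<close>, but not on \<open>ms\<close>.\<close>
  define c where "c = det (pairing_mat p (map g us @ fs) (map b cs))"
  have eq: "det (pairing_mat p fs ms) = c * det (pairing_mat p (map f cs) (us @ ms))"
    if ms: "set ms \<subseteq> X" "length ms = length fs" for ms
  proof -
    have "pairing_mat p fs us = 0\<^sub>m (length fs) (length us)"
    proof (rule eq_matI)
      fix i j assume ij: "i < dim_row (0\<^sub>m (length fs) (length us) :: complex mat)"
        "j < dim_col (0\<^sub>m (length fs) (length us) :: complex mat)"
      then have "fs ! i \<in> annihilator p Y U" "us ! j \<in> U"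
        using fsY U(4) V.span_superset[of "set us"] by (auto simp: subset_iff)
      with ij show "pairing_mat p fs us $$ (i, j) = 0\<^sub>m (length fs) (length us) $$ (i, j)"
        by (simp add: pairing_mat_def annihilator_def)
    qed simp_all
    moreover have "pairing_mat p (map g us) us = 1\<^sub>m (length us)"
      using C.pairing_mat_dual[OF U(2) C(1)] by simp
    \<comment> \<open>The lower left block is 0 because \<open>fs\<close> annihilates
      \<open>us\<close>, and the upper left block is the identity, so only the minor of
      \<open>fs\<close> and \<open>ms\<close> remains.\<close>
    ultimately have "det (pairing_mat p (map g us @ fs) (us @ ms)) = det (pairing_mat p fs ms)"
      unfolding pairing_mat_append
      by (subst det_four_block_mat_lower_left_zero[of _ "length us" _ "length fs"])
        (auto simp: pairing_mat_def ms)
    moreover have "pairing_mat p (map g us @ fs) (us @ ms) =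
        pairing_mat p (map g us @ fs) (map b cs) * pairing_mat p (map f cs) (us @ ms)"
      using C.f_in C(1) fsY ann usX ms(1) by (intro pairing_mat_mult[OF cs]) auto
    moreover have "det (pairing_mat p (map g us @ fs) (map b cs) * pairing_mat p (map f cs) (us @ ms)) =
        c * det (pairing_mat p (map f cs) (us @ ms))"
      unfolding c_def by (rule det_mult[of _ "length cs"]) (simp_all add: pairing_mat_def len ms(2))
    ultimately show ?thesis by metis
  qed
  \<comment> \<open>For \<open>ms\<close> dual to \<open>fs\<close> the minor is 1, which excludes
    \<open>c = 0\<close>. The transpose appears because \<open>D\<close> pairs in the opposite
    order.\<close>
  have "transpose_mat (pairing_mat p fs (map h fs)) = 1\<^sub>m (length fs)"
    unfolding transpose_pairing_mat using D.pairing_mat_dual[OF fs(1) D(1)] by simp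
  moreover have "det (transpose_mat (pairing_mat p fs (map h fs))) = det (pairing_mat p fs (map h fs))"
    by (rule det_transpose[of _ "length fs"]) (simp add: pairing_mat_def)
  ultimately have "det (pairing_mat p fs (map h fs)) = 1" by simp
  moreover have "set (map h fs) \<subseteq> X" using D.f_in D(1) by auto
  ultimately have "c \<noteq> 0" using eq[of "map h fs"] by auto
  then show "\<exists>c. c \<noteq> 0 \<and> (\<forall>ms. set ms \<subseteq> X \<and> length ms = length fs \<longrightarrow>
      det (pairing_mat p fs ms) = c * det (pairing_mat p (map f cs) (us @ ms)))"
    using eq by blast
qed

text \<open>Iterated Laplace expansion along the last column, with 0-based row and column numbers in
  the sign. The columns \<open>ms\<close> are stripped off from the right, hence listed in reverse.
  The rows left at the end index a minor of the remaining columns, supplied by \<open>x\<close>. The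
  result is a linear form in \<open>x\<close>.\<close>

primrec laplace :: "'v list \<Rightarrow> ('v \<Rightarrow> complex) list \<Rightarrow> (('v \<Rightarrow> complex) list \<Rightarrow> complex) \<Rightarrow> complex" where
  "laplace [] fs x = x fs"
| "laplace (m # ms) fs x =
     (\<Sum>i<length fs. (-1) ^ (i + (length fs - 1)) * (fs ! i) m * laplace ms (take i fs @ drop (Suc i) fs) x)"

text \<open>Every list of rows reached by the expansion is drawn from \<open>fs\<close>, so
  \<open>x\<close> has to agree with the minors on such lists only.\<close>

lemma laplace_det:
  assumes "length fs = length us + length ms"
    and "\<And>gs. set gs \<subseteq> set fs \<Longrightarrow> length gs = length us \<Longrightarrow> x gs = det (pairing_mat (\<lambda>f. f) gs us)"
  shows "laplace ms fs x = det (pairing_mat (\<lambda>f. f) fs (us @ rev ms))"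
  using assms
proof (induction ms arbitrary: fs)
  case (Cons m ms)
  define A where "A = pairing_mat (\<lambda>f. f) fs (us @ rev (m # ms))"
  let ?n = "length fs"
  have n: "?n = length us + length ms + 1" using Cons.prems(1) by simp
  have A: "A \<in> carrier_mat ?n ?n" 
    unfolding A_def using n by (simp add: pairing_mat_def)
  have "det A = (\<Sum>i<?n. A $$ (i, ?n - 1) * cofactor A i (?n - 1))"
    using n by (intro laplace_expansion_column[OF A]) simp
  also have "\<dots> = (\<Sum>i<?n. (-1) ^ (i + (?n - 1)) * (fs ! i) m * laplace ms (take i fs @ drop (Suc i) fs) x)"
  proof (rule sum.cong[OF refl])
    fix i assume "i \<in> {..<?n}"
    then have i: "i < ?n" by simp
    have set: "set (take i fs @ drop (Suc i) fs) \<subseteq> set fs"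
      using set_take_subset[of i fs] set_drop_subset[of "Suc i" fs] by auto
    have len: "length (take i fs @ drop (Suc i) fs) = length us + length ms"
      using i n by simp
    \<comment> \<open>Deleting row \<open>i\<close> and the last column leaves the pairing matrix of
      the other rows against \<open>us @ rev ms\<close>, to which the induction hypothesis
      applies.\<close>
    have "laplace ms (take i fs @ drop (Suc i) fs) x =
        det (pairing_mat (\<lambda>f. f) (take i fs @ drop (Suc i) fs) (us @ rev ms))"
    proof (rule Cons.IH[OF len])
      show "x gs = det (pairing_mat (\<lambda>f. f) gs us)"
        if "set gs \<subseteq> set (take i fs @ drop (Suc i) fs)" "length gs = length us" for gs
        using Cons.prems(2) that set by blast
    qed
    also have "pairing_mat (\<lambda>f. f) (take i fs @ drop (Suc i) fs) (us @ rev ms) = mat_delete A i (?n - 1)"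
      using i n by (intro eq_matI)
        (auto simp: mat_delete_def A_def pairing_mat_def nth_append min_def)
    finally show "A $$ (i, ?n - 1) * cofactor A i (?n - 1) =
        (-1) ^ (i + (?n - 1)) * (fs ! i) m * laplace ms (take i fs @ drop (Suc i) fs) x"
      using i n by (simp add: cofactor_def A_def pairing_mat_def nth_append)
  qed
  finally show ?case by (simp add: A_def)
qed simp

section \<open>Morphisms given by linear forms\<close>

lemma multihomogeneous_scale:
  assumes "multihomogeneous d P"
  shows "multihomogeneous d (\<lambda>x. c * P x)"
  using multihomogeneous.mult[OF multihomogeneous.const[of c] assms] by simp

text \<open>The form \<open>R\<close> shows that degree \<open>d\<close> occurs: the empty sum is
  obtained as 0 times \<open>R\<close>, since the constant rule provides degree 0 only.\<close>

lemma multihomogeneous_sum: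
  fixes P :: "'s \<Rightarrow> ('i \<Rightarrow> 'j \<Rightarrow> complex) \<Rightarrow> complex" and R :: "('i \<Rightarrow> 'j \<Rightarrow> complex) \<Rightarrow> complex"
  assumes "finite S" "\<And>s. s \<in> S \<Longrightarrow> multihomogeneous d (P s)" "multihomogeneous d R"
  shows "multihomogeneous d (\<lambda>x. \<Sum>s\<in>S. P s x)"
  using assms(1,2)
proof (induction S)
  case empty
  show ?case using multihomogeneous_scale[OF assms(3), of 0] by simp
next
  case (insert s S)
  then show ?case by (auto intro: multihomogeneous.add)
qed

lemma multihomogeneous_laplace:
  "multihomogeneous (\<lambda>k. if k = q then 1 else 0) (\<lambda>x. laplace ms fs (x q))"
proof (induction ms arbitrary: fs)
  case Nil
  show ?case by (simp add: multihomogeneous.coord)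
next
  case (Cons m ms)
  show ?case
    unfolding laplace.simps
    by (rule multihomogeneous_sum[OF _ _ multihomogeneous.coord])
      (auto intro: multihomogeneous_scale Cons.IH)
qed

text \<open>Each coordinate is replaced by a form of the same multidegree, so all degrees are
  preserved along the inductive construction.\<close>

lemma multihomogeneous_compose:
  assumes "multihomogeneous d P"
    and "\<And>i j. multihomogeneous (\<lambda>k. if k = i then 1 else 0) (\<lambda>x. L x i j)"
  shows "multihomogeneous d (\<lambda>x. P (L x))"
  using assms(1) by induction (auto intro: multihomogeneous.intros assms(2))

text \<open>There may be infinitely many projective factors, but a polynomial involves finitely
  many. This makes the product of scaling factors below meaningful.\<close>

lemma multihomogeneous_degree_finite: "finite {k. d k \<noteq> 0}" if "multihomogeneous d P"
  using that
proof induction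
  case (mult d P d' R)
  then show ?case by (auto intro: finite_subset[of _ "{k. d k \<noteq> 0} \<union> {k. d' k \<noteq> 0}"])
qed (auto intro: finite_subset)

lemma multihomogeneous_rescale:
  assumes "multihomogeneous d P"
  shows "P (\<lambda>i j. c i * x i j) = (\<Prod>k | d k \<noteq> 0. c k ^ d k) * P x"
  using assms
proof induction
  case (coord i j)
  have "(\<Prod>k | (if k = i then 1 else 0) \<noteq> (0::nat). c k ^ (if k = i then 1 else 0)) = (\<Prod>k\<in>{i}. c k)"
    by (intro prod.cong) auto
  then show ?case by simp
next
  case (mult d P d' R)
  have fin: "finite {k. d k \<noteq> 0}" "finite {k. d' k \<noteq> 0}"
    using mult.hyps multihomogeneous_degree_finite by blast+
  let ?S = "{k. d k + d' k \<noteq> 0}"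
  have S: "?S = {k. d k \<noteq> 0} \<union> {k. d' k \<noteq> 0}" by auto
  \<comment> \<open>On the larger support the additional factors have exponent 0.\<close>
  have "(\<Prod>k\<in>?S. c k ^ d k) = (\<Prod>k | d k \<noteq> 0. c k ^ d k)"
    "(\<Prod>k\<in>?S. c k ^ d' k) = (\<Prod>k | d' k \<noteq> 0. c k ^ d' k)"
    unfolding S using fin by (intro prod.mono_neutral_right; auto simp del: neq0_conv)+
  then show ?case by (simp add: mult.IH power_add prod.distrib mult_ac)
qed (simp_all add: distrib_left)

section \<open>The Zariski topology and pullback along linear forms\<close>

lemma openin_zariski_nonzero:
  assumes "multihomogeneous d P"
  shows "openin (zariski hc X) {u \<in> X. \<forall>x\<in>hc u. P x \<noteq> 0}"
  unfolding zariski_def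
  by (rule topology_generated_by_Basis, rule CollectI, rule exI[of _ P]) (use assms in blast)

lemma topspace_zariski [simp]: "topspace (zariski hc X) = X"
proof
  show "topspace (zariski hc X) \<subseteq> X"
    unfolding zariski_def topology_generated_by_topspace by auto
  show "X \<subseteq> topspace (zariski hc X)"
    using openin_subset[OF openin_zariski_nonzero[OF multihomogeneous.const[of 1], of hc X]] by simp
qed

text \<open>Substituting \<open>L\<close> pulls back nonvanishing loci to nonvanishing loci and
  fractions of equal degree to such fractions. Coordinate vectors of the image agree with
  \<open>L x\<close> up to one nonzero scalar per factor. The sets of coordinate vectors are
  nonempty, so conditions on all of them cannot hold vacuously.\<close>

lemma variety_morphism_linear:
  assumes F: "\<And>u. u \<in> X \<Longrightarrow> F u \<in> Y"
    and L: "\<And>i j. multihomogeneous (\<lambda>k. if k = i then 1 else 0) (\<lambda>x. L x i j)"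
    and hc: "\<And>u x y. u \<in> X \<Longrightarrow> x \<in> hcX u \<Longrightarrow> y \<in> hcY (F u) \<Longrightarrow>
               \<exists>c. (\<forall>i. c i \<noteq> 0) \<and> y = (\<lambda>i j. c i * L x i j)"
    and ne: "\<And>u. u \<in> X \<Longrightarrow> hcX u \<noteq> {}" "\<And>u. u \<in> X \<Longrightarrow> hcY (F u) \<noteq> {}"
  shows "variety_morphism hcX X hcY Y F"
proof -
  \<comment> \<open>The scalar \<open>k\<close> depends on the degree \<open>d\<close> but not on
    the polynomial \<open>P\<close>, so it is common to a numerator and its denominator.\<close>
  have rescale: "\<exists>k. k \<noteq> 0 \<and> (\<forall>P. multihomogeneous d P \<longrightarrow> P y = k * P (L x))"
    if uxy: "u \<in> X" "x \<in> hcX u" "y \<in> hcY (F u)" and fin: "finite {k. d k \<noteq> 0}" for u x y d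
  proof -
    obtain c where c: "\<forall>i. c i \<noteq> 0" "y = (\<lambda>i j. c i * L x i j)"
      using hc[OF uxy] by blast
    have "(\<Prod>k | d k \<noteq> 0. c k ^ d k) \<noteq> 0"
      using fin c(1) by simp
    then show ?thesis unfolding c(2) using multihomogeneous_rescale[of d _ c "L x"] by blast
  qed
  have cont: "continuous_map (zariski hcX X) (zariski hcY Y) F"
    unfolding zariski_def[of hcY]
  proof (rule continuous_on_generated_topo)
    fix U assume "U \<in> {{v \<in> Y. \<forall>y\<in>hcY v. P y \<noteq> 0} | P. \<exists>d. multihomogeneous d P}"
    then obtain P d where P: "multihomogeneous d P" "U = {v \<in> Y. \<forall>y\<in>hcY v. P y \<noteq> 0}" by blast
    \<comment> \<open>Nonvanishing at \<open>y\<close> and at \<open>L x\<close> agree for all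
      choices of \<open>x\<close> and \<open>y\<close>; as both kinds of vectors exist, the two
      universal conditions are equivalent.\<close>
    have "(\<forall>y\<in>hcY (F u). P y \<noteq> 0) \<longleftrightarrow> (\<forall>x\<in>hcX u. P (L x) \<noteq> 0)" if "u \<in> X" for u
      using rescale[OF that _ _ multihomogeneous_degree_finite[OF P(1)]] P(1) ne[OF that] by (metis all_not_in_conv mult_eq_0_iff)
    then have "F -` U \<inter> topspace (zariski hcX X) = {u \<in> X. \<forall>x\<in>hcX u. P (L x) \<noteq> 0}"
      using P(2) F by auto
    then show "openin (zariski hcX X) (F -` U \<inter> topspace (zariski hcX X))"
      using openin_zariski_nonzero[OF multihomogeneous_compose[OF P(1) L]] by simp
  next
    have "F ` topspace (zariski hcX X) \<subseteq> topspace (zariski hcY Y)" using F by auto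
    then show "F ` topspace (zariski hcX X) \<subseteq> \<Union> {{v \<in> Y. \<forall>y\<in>hcY v. P y \<noteq> 0} | P. \<exists>d. multihomogeneous d P}"
      unfolding zariski_def[of hcY] topology_generated_by_topspace .
  qed
  have pre: "openin (zariski hcX X) {u \<in> X. F u \<in> W}" if "openin (zariski hcY Y) W" for W
    using openin_continuous_map_preimage[OF cont that] by simp
  have "regular_on hcX X {u \<in> X. F u \<in> W} (\<lambda>u. f (F u))" if reg: "regular_on hcY Y W f" for W f
    unfolding regular_on_def
  proof (intro conjI ballI)
    show "openin (zariski hcX X) {u \<in> X. F u \<in> W}"
      using pre reg by (simp add: regular_on_def)
    fix u assume "u \<in> {u \<in> X. F u \<in> W}"
    then have u: "u \<in> X" "F u \<in> W" by auto
    from reg have "\<forall>w\<in>W. \<exists>W' d P R. openin (zariski hcY Y) W' \<and> w \<in> W' \<and> W' \<subseteq> W \<and>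
        multihomogeneous d P \<and> multihomogeneous d R \<and> (\<forall>v\<in>W'. \<forall>y\<in>hcY v. R y \<noteq> 0 \<and> f v = P y / R y)"
      unfolding regular_on_def by (rule conjunct2)
    from bspec[OF this u(2)] obtain W' d P R where W': "openin (zariski hcY Y) W'" "F u \<in> W'" "W' \<subseteq> W"
      and P: "multihomogeneous d P" and R: "multihomogeneous d R"
      and f: "\<forall>v\<in>W'. \<forall>y\<in>hcY v. R y \<noteq> 0 \<and> f v = P y / R y"
      by (elim exE conjE)
    have "R (L x) \<noteq> 0 \<and> f (F v) = P (L x) / R (L x)"
      if v: "v \<in> X" "F v \<in> W'" and x: "x \<in> hcX v" for v x
    proof -
      obtain y where y: "y \<in> hcY (F v)" using ne(2)[OF v(1)] by blast
      \<comment> \<open>Both polynomials have degree \<open>d\<close>, hence the same factor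
        \<open>k\<close>, which cancels in the quotient.\<close>
      obtain k where k: "k \<noteq> 0" "P y = k * P (L x)" "R y = k * R (L x)"
        using rescale[OF v(1) x y multihomogeneous_degree_finite[OF P]] P R by blast
      show ?thesis using bspec[OF bspec[OF f v(2)] y] k by simp
    qed
    then have "\<forall>v\<in>{u \<in> X. F u \<in> W'}. \<forall>x\<in>hcX v. R (L x) \<noteq> 0 \<and> f (F v) = P (L x) / R (L x)"
      by blast
    moreover have "{u \<in> X. F u \<in> W'} \<subseteq> {u \<in> X. F u \<in> W}" "u \<in> {u \<in> X. F u \<in> W'}"
      using W'(2,3) u(1) by auto
    ultimately show "\<exists>W' d P R. openin (zariski hcX X) W' \<and> u \<in> W' \<and> W' \<subseteq> {u \<in> X. F u \<in> W} \<and>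
        multihomogeneous d P \<and> multihomogeneous d R \<and>
        (\<forall>v\<in>W'. \<forall>x\<in>hcX v. R x \<noteq> 0 \<and> f (F v) = P x / R x)"
      using pre[OF W'(1)] multihomogeneous_compose[OF P L] multihomogeneous_compose[OF R L]
      by (intro exI conjI)
  qed
  then show ?thesis using cont by (simp add: variety_morphism_def)
qed

section \<open>Representations and their duals\<close>

lemma (in dual_pair) basis_list:
  assumes "U \<subseteq> X" "V.subspace U"
  shows "\<exists>us. distinct us \<and> is_basis_of sV (set us) U"
proof -
  obtain C where C: "C \<subseteq> U" "V.independent C" "U \<subseteq> V.span C"
    using V.basis_exists by metis
  have "finite C" using finite_independent C assms(1) by blast
  moreover have "V.span C = U" using C V.span_minimal[OF _ assms(2)] by blast
  ultimately show ?thesis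
    using C(2) finite_distinct_list[of C] by (auto simp: is_basis_of_def)
qed

lemma sum_fun_apply: "(\<Sum>i\<in>S. g i) x = (\<Sum>i\<in>S. g i x)"
  by (induction S rule: infinite_finite_induct) simp_all

lemma vector_space_fun: "vector_space (\<lambda>c (f :: 'v \<Rightarrow> complex) x. c * f x)"
  by unfold_locales (auto simp: fun_eq_iff algebra_simps)

lemma dual_rep_simps [simp]:
  "quiver (dual_rep M) = opposite_quiver (quiver M)"
  "rep_scale (dual_rep M) = (\<lambda>c f x. c * f x)"
  "rep_space (dual_rep M) = dual_space M"
  "verts (opposite_quiver Q) = verts Q"
  "arcs (opposite_quiver Q) = arcs Q"
  "tail (opposite_quiver Q) = head Q"
  "head (opposite_quiver Q) = tail Q"
  by (simp_all add: dual_rep_def opposite_quiver_def)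

lemma dual_subrep_annihilator:
  "dual_subrep M U = (\<lambda>q\<in>verts (quiver M). annihilator (\<lambda>f. f) (dual_space M q) (U q))"
  by (simp add: dual_subrep_def annihilator_def)

text \<open>The inverse of \<open>dual_subrep\<close>. The annihilator is taken directly in the
  spaces of \<open>M\<close>, which avoids the double dual.\<close>

definition predual_subrep ::
  "('q, 'a, 'v::ab_group_add) quiver_rep \<Rightarrow> ('q \<Rightarrow> ('v \<Rightarrow> complex) set) \<Rightarrow> 'q \<Rightarrow> 'v set" where
  "predual_subrep M T = (\<lambda>q\<in>verts (quiver M). annihilator (\<lambda>x f. f x) (rep_space M q) (T q))"

locale based_rep =
  fixes M :: "('q, 'a, 'v::ab_group_add) quiver_rep" and B :: "'v set" and r :: "('v \<times> 'v) set"
  assumes rep: "is_rep M" and fin_dim: "finite_dimensional_rep M" and basis: "ordered_basis M B r"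
begin

sublocale V: vector_space "rep_scale M"
  using rep by (simp add: is_rep_def)

sublocale W: vector_space "\<lambda>c (f :: 'v \<Rightarrow> complex) x. c * f x"
  by (rule vector_space_fun)

abbreviation "verts_M \<equiv> verts (quiver M)"

abbreviation "basis_at q \<equiv> B \<inter> rep_space M q"

abbreviation "dual_vec \<equiv> dual_functional M B"

section \<open>Homogeneous bases and dual functionals\<close>

lemma subspace_rep_space: "q \<in> verts_M \<Longrightarrow> V.subspace (rep_space M q)"
  using rep by (simp add: is_rep_def)

lemma basis_at:
  assumes "q \<in> verts_M"
  shows "V.independent (basis_at q)" "V.span (basis_at q) = rep_space M q"
  using basis assms by (auto simp: ordered_basis_def is_basis_of_def)

lemma basis_vertex:
  assumes "b \<in> B"
  obtains q where "q \<in> verts_M" "b \<in> rep_space M q"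
  using basis assms by (auto simp: ordered_basis_def)

text \<open>The sum of the spaces is direct, so a vector in two different summands is 0, which no
  basis element is.\<close>

lemma vertex_unique:
  assumes "q \<in> verts_M" "q' \<in> verts_M" "b \<in> B" "b \<in> rep_space M q" "b \<in> rep_space M q'"
  shows "q = q'"
proof (rule ccontr)
  assume "q \<noteq> q'"
  then have "b \<in> V.span (\<Union>p\<in>verts_M - {q}. rep_space M p)"
    using assms by (intro V.span_base) auto
  moreover have "rep_space M q \<inter> V.span (\<Union>p\<in>verts_M - {q}. rep_space M p) = {0}"
    using rep assms(1) by (simp add: is_rep_def)
  ultimately have "b = 0" using assms(4) by blast
  then show False using basis_at(1)[OF assms(1)] assms(3,4) V.dependent_zero by blast
qed

lemma finite_basis_at: "finite (basis_at q)" if q: "q \<in> verts_M"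
proof -
  obtain S where "finite S" "(\<Union>q\<in>verts_M. rep_space M q) \<subseteq> V.span S"
    using fin_dim by (auto simp: finite_dimensional_rep_def)
  then show ?thesis
    using V.independent_span_bound[of S "basis_at q"] basis_at(1)[OF q] q by blast
qed

text \<open>The vectors of the space at \<open>q\<close> where the two functionals agree form a
  subspace containing a basis; outside that space both are 0 by convention.\<close>

lemma dual_space_eqI:
  assumes q: "q \<in> verts_M" and f: "f \<in> dual_space M q" and g: "g \<in> dual_space M q"
    and eq: "\<And>b. b \<in> basis_at q \<Longrightarrow> f b = g b"
  shows "f = g"
proof
  fix x
  let ?T = "{x \<in> rep_space M q. f x = g x}"
  have "f (rep_scale M 0 0) = 0 * f 0" "g (rep_scale M 0 0) = 0 * g 0"
    using f g V.subspace_0[OF subspace_rep_space[OF q]] unfolding dual_space_def by blast+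
  then have "V.subspace ?T"
    using f g subspace_rep_space[OF q]
    by (simp add: V.subspace_def dual_space_def)
  then have "V.span (basis_at q) \<subseteq> ?T"
    using eq by (intro V.span_minimal) auto
  then have "f x = g x" if "x \<in> rep_space M q" using that basis_at(2)[OF q] by blast
  moreover have "f x = g x" if "x \<notin> rep_space M q" using that f g by (simp add: dual_space_def)
  ultimately show "f x = g x" by blast
qed

lemma dual_functional_ex:
  assumes q: "q \<in> verts_M" and b: "b \<in> basis_at q"
  shows "\<exists>f\<in>dual_space M q. \<forall>b'\<in>B. f b' = (if b' = b then 1 else 0)"
proof -
  define f where "f x = (if x \<in> rep_space M q then V.representation (basis_at q) x b else 0)" for x
  note S = subspace_rep_space[OF q]
  have "f \<in> dual_space M q"
    using V.subspace_add[OF S] V.subspace_scale[OF S]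
      V.representation_add[OF basis_at(1)[OF q]] V.representation_scale[OF basis_at(1)[OF q]]
    by (simp add: dual_space_def f_def basis_at(2)[OF q])
  moreover have "f b' = (if b' = b then 1 else 0)" if "b' \<in> B" for b'
    using that b by (auto simp: f_def V.representation_basis[OF basis_at(1)[OF q]])
  ultimately show ?thesis by blast
qed

text \<open>The definite description is justified here: existence comes from the coordinate
  function, uniqueness from agreement on a basis.\<close>

lemma dual_functional:
  assumes q: "q \<in> verts_M" and b: "b \<in> basis_at q"
  shows "dual_vec b \<in> dual_space M q" "\<And>b'. b' \<in> B \<Longrightarrow> dual_vec b b' = (if b' = b then 1 else 0)"
proof -
  obtain f where f: "f \<in> dual_space M q" "\<forall>b'\<in>B. f b' = (if b' = b then 1 else 0)"
    using dual_functional_ex[OF q b] by blast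
  have "dual_vec b = f"
    unfolding dual_functional_def
  proof (rule the_equality)
    show "f \<in> (\<Union>q\<in>verts_M. dual_space M q) \<and> (\<forall>b'\<in>B. f b' = (if b' = b then 1 else 0))"
      using f q by blast
    fix g assume g: "g \<in> (\<Union>q\<in>verts_M. dual_space M q) \<and> (\<forall>b'\<in>B. g b' = (if b' = b then 1 else 0))"
    then obtain p where p: "p \<in> verts_M" "g \<in> dual_space M p" by blast
    \<comment> \<open>A functional at \<open>p\<close> is 0 outside the space at \<open>p\<close>,
      so its nonzero value at \<open>b\<close> identifies the vertex.\<close>
    have "g b \<noteq> 0" using g b by simp
    then have "b \<in> rep_space M p" using p(2) unfolding dual_space_def by blast
    then have "p = q" using vertex_unique[OF p(1) q] b by blast
    then show "g = f"
      using g f p(2) by (intro dual_space_eqI[OF q]) auto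
  qed
  then show "dual_vec b \<in> dual_space M q" "\<And>b'. b' \<in> B \<Longrightarrow> dual_vec b b' = (if b' = b then 1 else 0)"
    using f by auto
qed

lemma dual_vec_apply: "b \<in> B \<Longrightarrow> b' \<in> B \<Longrightarrow> dual_vec b b' = (if b' = b then 1 else 0)"
  by (rule basis_vertex[of b]) (simp_all add: dual_functional(2))

lemma inj_dual_vec: "inj_on dual_vec B"
  by (rule inj_onI) (metis dual_vec_apply zero_neq_one)

lemma subspace_dual_space: "W.subspace (dual_space M q)"
  by (simp add: W.subspace_def dual_space_def algebra_simps)

lemma dual_vec_in_iff:
  assumes "q \<in> verts_M" "b \<in> B"
  shows "dual_vec b \<in> dual_space M q \<longleftrightarrow> b \<in> rep_space M q"
proof
  assume "dual_vec b \<in> dual_space M q"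
  moreover have "dual_vec b b \<noteq> 0" using dual_vec_apply assms by simp
  ultimately show "b \<in> rep_space M q" unfolding dual_space_def by blast
qed (use assms dual_functional(1) in blast)

text \<open>Evaluation is perfect at each vertex; a functional is recovered from its values at the
  basis as coefficients of the dual vectors.\<close>

lemma pair:
  assumes q: "q \<in> verts_M"
  shows "dual_pair (rep_scale M) (\<lambda>c f x. c * f x) (rep_space M q) (dual_space M q) (\<lambda>f. f)
    (basis_at q) (\<lambda>b. b) dual_vec"
proof unfold_locales
  have "dual_vec ` basis_at q \<subseteq> dual_space M q" using dual_functional(1)[OF q] by blast
  then have sub: "W.span (dual_vec ` basis_at q) \<subseteq> dual_space M q"
    by (rule W.span_minimal[OF _ subspace_dual_space])
  moreover have "f \<in> W.span (dual_vec ` basis_at q)" if f: "f \<in> dual_space M q" for f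
  proof -
    let ?g = "\<Sum>b\<in>basis_at q. (\<lambda>x. f b * dual_vec b x)"
    have g: "?g \<in> W.span (dual_vec ` basis_at q)"
      by (intro W.span_sum W.span_scale W.span_base imageI)
    have "f b = ?g b" if b: "b \<in> basis_at q" for b
    proof -
      have "?g b = (\<Sum>b'\<in>basis_at q. if b' = b then f b' else 0)"
        unfolding sum_fun_apply using b by (intro sum.cong) (auto simp: dual_vec_apply)
      then show ?thesis using b finite_basis_at[OF q] by simp
    qed
    then have "f = ?g" using g sub by (intro dual_space_eqI[OF q f]) auto
    then show ?thesis using g by simp
  qed
  ultimately show "W.span (dual_vec ` basis_at q) = dual_space M q" by blast
  show "V.span ((\<lambda>b. b) ` basis_at q) = rep_space M q" using basis_at(2)[OF q] by simp
qed (use finite_basis_at[OF q] in \<open>auto simp: dual_space_def dual_vec_apply\<close>)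

section \<open>Annihilators as subrepresentations\<close>

lemma dimension_vector: "q \<in> verts_M \<Longrightarrow> dimension_vector M q = card (basis_at q)"
  unfolding dimension_vector_def using dual_pair.dim_X[OF pair] by simp

lemma quiver_GrD:
  assumes "U \<in> quiver_Gr M e" "q \<in> verts_M"
  shows "U q \<subseteq> rep_space M q" "V.subspace (U q)" "V.dim (U q) = e q"
  using assms by (auto simp: quiver_Gr_def subreps_def PiE_iff)

lemma dual_quiver_GrD:
  assumes "T \<in> quiver_Gr (dual_rep M) e" "q \<in> verts_M"
  shows "T q \<subseteq> dual_space M q" "W.subspace (T q)" "W.dim (T q) = e q"
  using assms by (auto simp: quiver_Gr_def subreps_def PiE_iff)

lemma rep_map_arc:
  assumes "a \<in> arcs (quiver M)" "x \<in> rep_space M (tail (quiver M) a)"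
  shows "rep_map M a x \<in> rep_space M (head (quiver M) a)"
  using rep assms by (simp add: is_rep_def)

lemma arc_verts:
  assumes "a \<in> arcs (quiver M)"
  shows "tail (quiver M) a \<in> verts_M" "head (quiver M) a \<in> verts_M"
  using rep assms wf_digraph.tail_in_verts wf_digraph.head_in_verts by (auto simp: is_rep_def)

lemma dual_rep_map_in:
  assumes a: "a \<in> arcs (quiver M)" and f: "f \<in> dual_space M (head (quiver M) a)"
  shows "rep_map (dual_rep M) a f \<in> dual_space M (tail (quiver M) a)"
proof -
  note S = subspace_rep_space[OF arc_verts(1)[OF a]]
  have lin: "rep_map M a (x + y) = rep_map M a x + rep_map M a y"
    "rep_map M a (rep_scale M c x) = rep_scale M c (rep_map M a x)"
    if "x \<in> rep_space M (tail (quiver M) a)" "y \<in> rep_space M (tail (quiver M) a)" for x y c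
    using rep a that by (simp_all add: is_rep_def)
  show ?thesis
    using f V.subspace_add[OF S] V.subspace_scale[OF S]
    by (simp add: dual_rep_def dual_space_def lin rep_map_arc[OF a])
qed

text \<open>The adjoint of an arc map is precomposition: if the arc maps \<open>U\<close> at its
  tail into \<open>U\<close> at its head, functionals killing the latter pull back to functionals
  killing the former.\<close>

lemma dual_subrep_in_Gr:
  assumes U: "U \<in> quiver_Gr M e"
  shows "dual_subrep M U \<in> quiver_Gr (dual_rep M) (\<lambda>q. dimension_vector M q - e q)"
proof -
  have "rep_map (dual_rep M) a f \<in> annihilator (\<lambda>f. f) (dual_space M (tail (quiver M) a)) (U (tail (quiver M) a))"
    if a: "a \<in> arcs (quiver M)"
      and f: "f \<in> annihilator (\<lambda>f. f) (dual_space M (head (quiver M) a)) (U (head (quiver M) a))" for a f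
  proof -
    have "rep_map M a ` U (tail (quiver M) a) \<subseteq> U (head (quiver M) a)"
      using U a by (simp add: quiver_Gr_def subreps_def)
    then have "rep_map (dual_rep M) a f x = 0" if "x \<in> U (tail (quiver M) a)" for x
      using that f by (auto simp: dual_rep_def annihilator_def)
    then show ?thesis
      using f dual_rep_map_in[OF a] by (simp add: annihilator_def)
  qed
  moreover have "W.subspace (annihilator (\<lambda>f. f) (dual_space M q) (U q))"
    "W.dim (annihilator (\<lambda>f. f) (dual_space M q) (U q)) = dimension_vector M q - e q"
    if q: "q \<in> verts_M" for q
    using dual_pair.subspace_annihilator[OF pair[OF q]] dual_pair.dim_annihilator[OF pair[OF q]]
      quiver_GrD[OF U q] dimension_vector[OF q] by auto
  ultimately show ?thesis
    using arc_verts
    by (auto simp: quiver_Gr_def subreps_def dual_subrep_annihilator PiE_iff annihilator_def)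
qed

text \<open>The same adjunction read backwards. The bound on \<open>e\<close> makes the truncated
  subtraction exact: taking the complementary dimension twice gives \<open>e q\<close> back.\<close>

lemma predual_subrep_in_Gr:
  assumes T: "T \<in> quiver_Gr (dual_rep M) (\<lambda>q. dimension_vector M q - e q)"
    and e: "\<And>q. q \<in> verts_M \<Longrightarrow> e q \<le> dimension_vector M q"
  shows "predual_subrep M T \<in> quiver_Gr M e"
proof -
  have "rep_map M a x \<in> annihilator (\<lambda>x f. f x) (rep_space M (head (quiver M) a)) (T (head (quiver M) a))"
    if a: "a \<in> arcs (quiver M)"
      and x: "x \<in> annihilator (\<lambda>x f. f x) (rep_space M (tail (quiver M) a)) (T (tail (quiver M) a))" for a x
  proof -
    have "rep_map (dual_rep M) a ` T (head (quiver M) a) \<subseteq> T (tail (quiver M) a)"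
      using T a by (simp add: quiver_Gr_def subreps_def)
    then have "rep_map (dual_rep M) a f x = 0" if "f \<in> T (head (quiver M) a)" for f
      using that x by (auto simp: annihilator_def)
    then have "f (rep_map M a x) = 0" if "f \<in> T (head (quiver M) a)" for f
      using that x by (simp add: dual_rep_def annihilator_def)
    then show ?thesis
      using x rep_map_arc[OF a] by (simp add: annihilator_def)
  qed
  moreover have "V.subspace (annihilator (\<lambda>x f. f x) (rep_space M q) (T q))"
    "V.dim (annihilator (\<lambda>x f. f x) (rep_space M q) (T q)) = e q"
    if q: "q \<in> verts_M" for q
    using dual_pair.subspace_annihilator[OF dual_pair.swap[OF pair[OF q]]]
      dual_pair.dim_annihilator[OF dual_pair.swap[OF pair[OF q]]]
      dual_quiver_GrD[OF T q] dimension_vector[OF q] e[OF q] by auto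
  ultimately show ?thesis
    using arc_verts
    by (auto simp: quiver_Gr_def subreps_def predual_subrep_def PiE_iff annihilator_def)
qed

lemma predual_dual_subrep:
  assumes U: "U \<in> quiver_Gr M e"
  shows "predual_subrep M (dual_subrep M U) = U"
proof
  fix q
  show "predual_subrep M (dual_subrep M U) q = U q"
  proof (cases "q \<in> verts_M")
    case True
    then show ?thesis
      using dual_pair.annihilator_annihilator[OF pair[OF True]] quiver_GrD[OF U True]
      by (simp add: predual_subrep_def dual_subrep_annihilator)
  next
    case False
    then show ?thesis
      using U by (simp add: predual_subrep_def quiver_Gr_def subreps_def PiE_iff extensional_def)
  qed
qed

lemma dual_predual_subrep:
  assumes T: "T \<in> quiver_Gr (dual_rep M) e"
  shows "dual_subrep M (predual_subrep M T) = T"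
proof
  fix q
  show "dual_subrep M (predual_subrep M T) q = T q"
  proof (cases "q \<in> verts_M")
    case True
    then show ?thesis
      using dual_pair.annihilator_annihilator[OF dual_pair.swap[OF pair[OF True]]] dual_quiver_GrD[OF T True]
      by (simp add: predual_subrep_def dual_subrep_annihilator)
  next
    case False
    then show ?thesis
      using T by (simp add: dual_subrep_annihilator quiver_Gr_def subreps_def PiE_iff extensional_def)
  qed
qed

end

section \<open>Pluecker coordinates of dual subrepresentations\<close>

lemma length_basis:
  assumes "vector_space s" "distinct us" "is_basis_of s (set us) U"
  shows "length us = vector_space.dim s U"
  using vector_space.dim_span_eq_card_independent[OF assms(1), of "set us"] assms(2,3)
  by (simp add: is_basis_of_def distinct_card)

lemma plucker_vector_pairing:
  "plucker_vector M us q fs =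
     (if q \<in> verts (quiver M) \<and> set fs \<subseteq> dual_space M q \<and> length fs = length (us q)
      then det (pairing_mat (\<lambda>f. f) fs (us q)) else 0)"
  by (simp add: plucker_vector_def pairing_mat_def)

lemma det_pairing_mat_transpose:
  assumes "length fs = length us"
  shows "det (pairing_mat p fs us) = det (pairing_mat (\<lambda>x y. p y x) us fs)"
proof -
  have "det (transpose_mat (pairing_mat p fs us)) = det (pairing_mat p fs us)"
    by (rule det_transpose[of _ "length fs"]) (simp add: pairing_mat_def assms)
  then show ?thesis by (simp only: transpose_pairing_mat)
qed

text \<open>Injectivity of \<open>h\<close> turns sums over image vectors into sums over indices. It
  is applied to the map from basis elements to their dual functionals.\<close>

lemma echelon_reindex:
  fixes h :: "'v \<Rightarrow> 'w::ab_group_add"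
  assumes "inj_on h I" "J \<subseteq> I" "K \<subseteq> I"
  shows "(\<lambda>y. y + (\<Sum>y' | y' \<in> h ` J \<and> (y', y) \<in> ro \<and> y' \<noteq> y. s (w y' y) y')) ` (h ` K) =
    (\<lambda>i. h i + (\<Sum>j | j \<in> J \<and> (h j, h i) \<in> ro \<and> j \<noteq> i. s (w (h j) (h i)) (h j))) ` K"
proof -
  have "(\<Sum>y' | y' \<in> h ` J \<and> (y', h i) \<in> ro \<and> y' \<noteq> h i. s (w y' (h i)) y') =
      (\<Sum>j | j \<in> J \<and> (h j, h i) \<in> ro \<and> j \<noteq> i. s (w (h j) (h i)) (h j))" if i: "i \<in> K" for i
  proof -
    let ?S = "{j. j \<in> J \<and> (h j, h i) \<in> ro \<and> j \<noteq> i}"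
    have "{y'. y' \<in> h ` J \<and> (y', h i) \<in> ro \<and> y' \<noteq> h i} = h ` ?S"
      using assms i by (auto simp: inj_on_def subset_iff)
    moreover have "inj_on h ?S" using assms(1,2) by (auto simp: inj_on_def)
    ultimately show ?thesis by (simp add: sum.reindex)
  qed
  then show ?thesis by (simp add: image_image)
qed

section \<open>Coordinates of annihilators at a single vertex\<close>

context based_rep
begin

text \<open>An arbitrary enumeration, unrelated to the order \<open>r\<close>; it only orders the
  rows of matrices.\<close>

definition basis_enum :: "'q \<Rightarrow> 'v list" where
  "basis_enum q = (SOME bs. distinct bs \<and> set bs = basis_at q)"

lemma basis_enum: "distinct (basis_enum q)" "set (basis_enum q) = basis_at q" if "q \<in> verts_M"
  using someI_ex[OF finite_distinct_list[OF finite_basis_at[OF that]], of]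
  unfolding basis_enum_def by (simp_all add: conj_commute)

lemma plucker_nonempty: "plucker M U \<noteq> {}" if U: "U \<in> quiver_Gr M e"
proof -
  have "\<forall>q\<in>verts_M. \<exists>us. distinct us \<and> is_basis_of (rep_scale M) (set us) (U q)"
    using dual_pair.basis_list[OF pair] quiver_GrD[OF U] by blast
  then obtain us where "\<forall>q\<in>verts_M. distinct (us q) \<and> is_basis_of (rep_scale M) (set (us q)) (U q)"
    by metis
  then show ?thesis unfolding plucker_def by blast
qed

lemma dual_plucker_nonempty: "plucker (dual_rep M) T \<noteq> {}" if T: "T \<in> quiver_Gr (dual_rep M) e"
proof -
  have "\<forall>q\<in>verts_M. \<exists>fs. distinct fs \<and> is_basis_of (\<lambda>c f x. c * f x) (set fs) (T q)"
    using dual_pair.basis_list[OF dual_pair.swap[OF pair]] dual_quiver_GrD[OF T] by blast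
  then obtain fs where "\<forall>q\<in>verts_M. distinct (fs q) \<and> is_basis_of (\<lambda>c f x. c * f x) (set (fs q)) (T q)"
    by metis
  then show ?thesis unfolding plucker_def by auto
qed

text \<open>The inverse of the canonical isomorphism onto the double dual. Coordinates of the dual
  representation are indexed by functionals on functionals, which this turns into vectors of
  \<open>M\<close>.\<close>

definition representing_vector :: "'q \<Rightarrow> (('v \<Rightarrow> complex) \<Rightarrow> complex) \<Rightarrow> 'v" where
  "representing_vector q \<Phi> = (\<Sum>b\<in>basis_at q. rep_scale M (\<Phi> (dual_vec b)) b)"

lemma representing_vector:
  assumes q: "q \<in> verts_M" and \<Phi>: "\<Phi> \<in> dual_space (dual_rep M) q"
  shows "representing_vector q \<Phi> \<in> rep_space M q"
    "\<And>f. f \<in> dual_space M q \<Longrightarrow> f (representing_vector q \<Phi>) = \<Phi> f"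
proof -
  interpret P: dual_pair "rep_scale M" "\<lambda>c f x. c * f x" "rep_space M q" "dual_space M q" "\<lambda>f. f"
    "basis_at q" "\<lambda>b. b" dual_vec by (rule pair[OF q])
  show "representing_vector q \<Phi> \<in> rep_space M q"
    unfolding representing_vector_def
    by (intro V.subspace_sum[OF P.subspace_X] V.subspace_scale[OF P.subspace_X]) auto
  fix f assume f: "f \<in> dual_space M q"
  have "f (representing_vector q \<Phi>) = (\<Sum>b\<in>basis_at q. \<Phi> (dual_vec b) * f b)"
    unfolding representing_vector_def using f P.fin P.b_in by (intro P.linear_combination_right) auto
  also have "\<dots> = (\<Sum>b\<in>basis_at q. f b * \<Phi> (dual_vec b))" by (simp add: mult.commute)
  also have "\<dots> = \<Phi> (\<Sum>b\<in>basis_at q. (\<lambda>x. f b * dual_vec b x))"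
  proof (rule W.functional_linear_combination[OF subspace_dual_space[of q], symmetric])
    show "\<Phi> (g + h) = \<Phi> g + \<Phi> h" if "g \<in> dual_space M q" "h \<in> dual_space M q" for g h
      using \<Phi> that unfolding dual_space_def[of "dual_rep M"] dual_rep_simps by blast
    show "\<Phi> (\<lambda>x. c * g x) = c * \<Phi> g" if "g \<in> dual_space M q" for c g
      using \<Phi> that unfolding dual_space_def[of "dual_rep M"] dual_rep_simps by blast
  qed (use P.fin P.f_in in auto)
  also have "(\<Sum>b\<in>basis_at q. (\<lambda>x. f b * dual_vec b x)) = f"
    using dual_pair.expand[OF P.swap f] by simp
  finally show "f (representing_vector q \<Phi>) = \<Phi> f" .
qed

text \<open>The canonical map into the double dual, cut off by 0 outside
  \<open>dual_space M q\<close> as the encoding of functionals requires.\<close>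

definition eval_at :: "'q \<Rightarrow> 'v \<Rightarrow> ('v \<Rightarrow> complex) \<Rightarrow> complex" where
  "eval_at q x f = (if f \<in> dual_space M q then f x else 0)"

lemma eval_at_in: "eval_at q x \<in> dual_space (dual_rep M) q" if "x \<in> rep_space M q"
  using that W.subspace_add[OF subspace_dual_space[of q]] W.subspace_scale[OF subspace_dual_space[of q]]
  by (simp add: dual_space_def[of "dual_rep M"] eval_at_def)

text \<open>After \<open>\<Phi>s\<close> is replaced by representing vectors and the matrix
  transposed, the coordinate is a minor of the annihilator. \<open>minors_annihilator\<close> and
  Laplace expansion express it through the coordinates of \<open>U\<close>, with a factor
  independent of \<open>\<Phi>s\<close>.\<close>

lemma dual_plucker_coordinates:
  assumes q: "q \<in> verts_M" and U: "U \<subseteq> rep_space M q"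
    and us: "distinct (us q)" "is_basis_of (rep_scale M) (set (us q)) U"
    and fs: "distinct (fs q)" "is_basis_of (\<lambda>c f x. c * f x) (set (fs q)) (annihilator (\<lambda>f. f) (dual_space M q) U)"
  shows "\<exists>c. c \<noteq> 0 \<and> (\<forall>\<Phi>s. set \<Phi>s \<subseteq> dual_space (dual_rep M) q \<and> length \<Phi>s = length (fs q) \<longrightarrow>
    plucker_vector (dual_rep M) fs q \<Phi>s =
      c * laplace (rev (map (representing_vector q) \<Phi>s)) (map dual_vec (basis_enum q)) (plucker_vector M us q))"
proof -
  interpret P: dual_pair "rep_scale M" "\<lambda>c f x. c * f x" "rep_space M q" "dual_space M q" "\<lambda>f. f"
    "basis_at q" "\<lambda>b. b" dual_vec by (rule pair[OF q])
  note bs = basis_enum[OF q]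
  obtain c where c: "c \<noteq> 0" "\<forall>ms. set ms \<subseteq> rep_space M q \<and> length ms = length (fs q) \<longrightarrow>
      det (pairing_mat (\<lambda>f. f) (fs q) ms) = c * det (pairing_mat (\<lambda>f. f) (map dual_vec (basis_enum q)) (us q @ ms))"
    using P.minors_annihilator(2)[OF bs U us(1) _ _ fs(1)] us(2) fs(2) unfolding is_basis_of_def by blast
  have fsY: "set (fs q) \<subseteq> dual_space M q"
    using fs(2) W.span_superset[of "set (fs q)"] by (auto simp: is_basis_of_def annihilator_def)
  have len: "length (us q) + length (fs q) = length (basis_enum q)"
    using us(2) fs(2) by (intro P.minors_annihilator(1)[OF bs U us(1) _ _ fs(1)]) (simp_all add: is_basis_of_def)
  have "plucker_vector (dual_rep M) fs q \<Phi>s =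
      c * laplace (rev (map (representing_vector q) \<Phi>s)) (map dual_vec (basis_enum q)) (plucker_vector M us q)"
    if \<Phi>s: "set \<Phi>s \<subseteq> dual_space (dual_rep M) q" "length \<Phi>s = length (fs q)" for \<Phi>s
  proof -
    let ?ms = "map (representing_vector q) \<Phi>s"
    have ms: "set ?ms \<subseteq> rep_space M q" using \<Phi>s(1) representing_vector(1)[OF q] by auto
    have "plucker_vector (dual_rep M) fs q \<Phi>s = det (pairing_mat (\<lambda>f. f) \<Phi>s (fs q))"
      using \<Phi>s q by (simp add: plucker_vector_pairing)
    also have "pairing_mat (\<lambda>f. f) \<Phi>s (fs q) = pairing_mat (\<lambda>x f. f x) ?ms (fs q)"
      using \<Phi>s fsY by (intro pairing_mat_cong) (simp_all add: representing_vector(2)[OF q] subset_iff)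
    also have "det \<dots> = det (pairing_mat (\<lambda>f. f) (fs q) ?ms)"
      using \<Phi>s by (subst det_pairing_mat_transpose) simp_all
    also have "\<dots> = c * det (pairing_mat (\<lambda>f. f) (map dual_vec (basis_enum q)) (us q @ ?ms))"
      using c(2)[rule_format, of ?ms] \<Phi>s(2) ms by simp
    also have "det (pairing_mat (\<lambda>f. f) (map dual_vec (basis_enum q)) (us q @ ?ms)) =
        laplace (rev ?ms) (map dual_vec (basis_enum q)) (plucker_vector M us q)"
    \<comment> \<open>The rows are dual basis vectors, so the indices met in the expansion are lists
      of functionals at \<open>q\<close>, where \<open>plucker_vector\<close> is a genuine
      minor.\<close>
    proof (subst laplace_det[of _ "us q"])
      show "plucker_vector M us q gs = det (pairing_mat (\<lambda>f. f) gs (us q))"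
        if "set gs \<subseteq> set (map dual_vec (basis_enum q))" "length gs = length (us q)" for gs
      proof -
        have "set gs \<subseteq> dual_space M q" using that(1) bs(2) P.f_in by auto
        then show ?thesis using that(2) q by (simp add: plucker_vector_pairing)
      qed
    qed (use len \<Phi>s in simp_all)
    finally show ?thesis .
  qed
  then show ?thesis using c(1) by blast
qed

text \<open>The mirror argument for the swapped pairing. The indices are functionals already, while
  the rows of the expansion are basis vectors seen as evaluations in the double dual.\<close>

lemma plucker_coordinates:
  assumes q: "q \<in> verts_M" and T: "T \<subseteq> dual_space M q"
    and fs: "distinct (fs q)" "is_basis_of (\<lambda>c f x. c * f x) (set (fs q)) T"
    and us: "distinct (us q)" "is_basis_of (rep_scale M) (set (us q)) (annihilator (\<lambda>x f. f x) (rep_space M q) T)"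
  shows "\<exists>c. c \<noteq> 0 \<and> (\<forall>gs. set gs \<subseteq> dual_space M q \<and> length gs = length (us q) \<longrightarrow>
    plucker_vector M us q gs =
      c * laplace (rev gs) (map (eval_at q) (basis_enum q)) (plucker_vector (dual_rep M) fs q))"
proof -
  interpret P: dual_pair "rep_scale M" "\<lambda>c f x. c * f x" "rep_space M q" "dual_space M q" "\<lambda>f. f"
    "basis_at q" "\<lambda>b. b" dual_vec by (rule pair[OF q])
  interpret S: dual_pair "\<lambda>c f x. c * f x" "rep_scale M" "dual_space M q" "rep_space M q" "\<lambda>x f. f x"
    "basis_at q" dual_vec "\<lambda>b. b" by (rule P.swap)
  note bs = basis_enum[OF q]
  obtain c where c: "c \<noteq> 0" "\<forall>gs. set gs \<subseteq> dual_space M q \<and> length gs = length (us q) \<longrightarrow>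
      det (pairing_mat (\<lambda>x f. f x) (us q) gs) = c * det (pairing_mat (\<lambda>x f. f x) (map (\<lambda>b. b) (basis_enum q)) (fs q @ gs))"
    using S.minors_annihilator(2)[OF bs T fs(1) _ _ us(1)] us(2) fs(2) unfolding is_basis_of_def by blast
  have fsY: "set (fs q) \<subseteq> dual_space M q"
    using fs(2) T W.span_superset[of "set (fs q)"] by (auto simp: is_basis_of_def)
  have len: "length (fs q) + length (us q) = length (basis_enum q)"
    using us(2) fs(2) by (intro S.minors_annihilator(1)[OF bs T fs(1) _ _ us(1)]) (simp_all add: is_basis_of_def)
  have "plucker_vector M us q gs =
      c * laplace (rev gs) (map (eval_at q) (basis_enum q)) (plucker_vector (dual_rep M) fs q)"
    if gs: "set gs \<subseteq> dual_space M q" "length gs = length (us q)" for gs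
  proof -
    have "plucker_vector M us q gs = det (pairing_mat (\<lambda>f. f) gs (us q))"
      using gs q by (simp add: plucker_vector_pairing)
    also have "\<dots> = det (pairing_mat (\<lambda>x f. f x) (us q) gs)"
      using gs by (subst det_pairing_mat_transpose) simp_all
    also have "\<dots> = c * det (pairing_mat (\<lambda>x f. f x) (basis_enum q) (fs q @ gs))"
      using c(2) gs by simp
    also have "pairing_mat (\<lambda>x f. f x) (basis_enum q) (fs q @ gs) =
        pairing_mat (\<lambda>f. f) (map (eval_at q) (basis_enum q)) (fs q @ gs)"
    proof (intro pairing_mat_cong)
      fix i j assume "i < length (basis_enum q)" "j < length (fs q @ gs)"
      moreover from this have "(fs q @ gs) ! j \<in> dual_space M q"
        using nth_mem[of j "fs q @ gs"] fsY gs(1) by auto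
      ultimately show "((fs q @ gs) ! j) (basis_enum q ! i) =
          (map (eval_at q) (basis_enum q) ! i) ((fs q @ gs) ! j)"
        by (simp add: eval_at_def)
    qed simp_all
    also have "det \<dots> = laplace (rev gs) (map (eval_at q) (basis_enum q)) (plucker_vector (dual_rep M) fs q)"
    proof (subst laplace_det[of _ "fs q"])
      show "plucker_vector (dual_rep M) fs q \<Phi>s = det (pairing_mat (\<lambda>f. f) \<Phi>s (fs q))"
        if "set \<Phi>s \<subseteq> set (map (eval_at q) (basis_enum q))" "length \<Phi>s = length (fs q)" for \<Phi>s
      proof -
        have "set \<Phi>s \<subseteq> dual_space (dual_rep M) q" using that(1) bs(2) eval_at_in by auto
        then show ?thesis using that(2) q by (simp add: plucker_vector_pairing)
      qed
    qed (use len gs in simp_all)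
    finally show ?thesis .
  qed
  then show ?thesis using c(1) by blast
qed

lemma dual_subrep_morphism:
  assumes A: "A \<subseteq> quiver_Gr M e" and A': "\<And>U. U \<in> A \<Longrightarrow> dual_subrep M U \<in> A'"
  shows "variety_morphism (plucker M) A (plucker (dual_rep M)) A' (dual_subrep M)"
proof -
  let ?good = "\<lambda>q \<Phi>s. q \<in> verts_M \<and> set \<Phi>s \<subseteq> dual_space (dual_rep M) q \<and>
    length \<Phi>s = dimension_vector M q - e q"
  \<comment> \<open>The admissible length is a dimension, so \<open>L\<close> does not depend on the
    point. The default is 0 written as a multiple of a coordinate, because it must be a form of
    degree 1 in the factor \<open>q\<close>.\<close>
  define L where "L x q \<Phi>s = (if ?good q \<Phi>s
      then laplace (rev (map (representing_vector q) \<Phi>s)) (map dual_vec (basis_enum q)) (x q)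
      else 0 * x q [])" for x :: "'q \<Rightarrow> ('v \<Rightarrow> complex) list \<Rightarrow> complex" and q \<Phi>s
  show ?thesis
  proof (rule variety_morphism_linear[where L = L])
    show "multihomogeneous (\<lambda>k. if k = q then 1 else 0) (\<lambda>x. L x q \<Phi>s)" for q \<Phi>s
    proof (cases "?good q \<Phi>s")
      case True
      then show ?thesis unfolding L_def if_P[OF True] by (intro multihomogeneous_laplace)
    next
      case False
      show ?thesis unfolding L_def if_not_P[OF False]
        by (rule multihomogeneous_scale[OF multihomogeneous.coord])
    qed
  next
    fix U x y assume U: "U \<in> A" and x: "x \<in> plucker M U"
      and y: "y \<in> plucker (dual_rep M) (dual_subrep M U)"
    have U': "U \<in> quiver_Gr M e" using A U by blast
    obtain us where us: "x = plucker_vector M us"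
      "\<And>q. q \<in> verts_M \<Longrightarrow> distinct (us q)"
      "\<And>q. q \<in> verts_M \<Longrightarrow> is_basis_of (rep_scale M) (set (us q)) (U q)"
      using x unfolding plucker_def by blast
    obtain fs where fs: "y = plucker_vector (dual_rep M) fs"
      "\<And>q. q \<in> verts_M \<Longrightarrow> distinct (fs q)"
      "\<And>q. q \<in> verts_M \<Longrightarrow> is_basis_of (\<lambda>c f x. c * f x) (set (fs q)) (dual_subrep M U q)"
      using y unfolding plucker_def by auto
    have len: "length (fs q) = dimension_vector M q - e q" if q: "q \<in> verts_M" for q
      using length_basis[OF vector_space_fun fs(2,3)[OF q]]
        dual_quiver_GrD(3)[OF dual_subrep_in_Gr[OF U'] q] by simp
    have "\<exists>c. c \<noteq> 0 \<and> (\<forall>\<Phi>s. set \<Phi>s \<subseteq> dual_space (dual_rep M) q \<and> length \<Phi>s = length (fs q) \<longrightarrow>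
        y q \<Phi>s = c * laplace (rev (map (representing_vector q) \<Phi>s)) (map dual_vec (basis_enum q)) (x q))"
      if q: "q \<in> verts_M" for q
      unfolding us(1) fs(1)
      using fs(3)[OF q] q
      by (intro dual_plucker_coordinates[where us = us and fs = fs, OF q quiver_GrD(1)[OF U' q] us(2,3)[OF q] fs(2)[OF q]])
        (simp add: dual_subrep_annihilator)
    then obtain c where c: "\<And>q. q \<in> verts_M \<Longrightarrow> c q \<noteq> 0 \<and>
        (\<forall>\<Phi>s. set \<Phi>s \<subseteq> dual_space (dual_rep M) q \<and> length \<Phi>s = length (fs q) \<longrightarrow>
          y q \<Phi>s = c q * laplace (rev (map (representing_vector q) \<Phi>s)) (map dual_vec (basis_enum q)) (x q))"
      by metis
    \<comment> \<open>Scalars must be nonzero in every factor; away from the vertices all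
      coordinates are 0, so any nonzero value works.\<close>
    define c' where "c' q = (if q \<in> verts_M then c q else 1)" for q
    have "y q \<Phi>s = c' q * L x q \<Phi>s" for q \<Phi>s
    proof (cases "?good q \<Phi>s")
      case True
      then show ?thesis unfolding L_def if_P[OF True] using c len by (simp add: c'_def)
    next
      case False
      then have "y q \<Phi>s = 0" unfolding fs(1) plucker_vector_pairing using len by auto
      then show ?thesis unfolding L_def if_not_P[OF False] by simp
    qed
    moreover have "\<forall>q. c' q \<noteq> 0" using c by (simp add: c'_def)
    ultimately show "\<exists>c. (\<forall>q. c q \<noteq> 0) \<and> y = (\<lambda>q \<Phi>s. c q * L x q \<Phi>s)" by blast
  next
    show "plucker M U \<noteq> {}" if "U \<in> A" for U using plucker_nonempty that A by blast
    show "plucker (dual_rep M) (dual_subrep M U) \<noteq> {}" if "U \<in> A" for U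
      using dual_plucker_nonempty[OF dual_subrep_in_Gr] that A by blast
  qed (rule A')
qed

lemma predual_subrep_morphism:
  assumes e: "\<And>q. q \<in> verts_M \<Longrightarrow> e q \<le> dimension_vector M q"
    and A': "A' \<subseteq> quiver_Gr (dual_rep M) (\<lambda>q. dimension_vector M q - e q)"
    and A: "\<And>T. T \<in> A' \<Longrightarrow> predual_subrep M T \<in> A"
  shows "variety_morphism (plucker (dual_rep M)) A' (plucker M) A (predual_subrep M)"
proof -
  let ?good = "\<lambda>q gs. q \<in> verts_M \<and> set gs \<subseteq> dual_space M q \<and> length gs = e q"
  \<comment> \<open>As for the dual direction, the default is a vanishing form of degree 1 in the
    factor \<open>q\<close>.\<close>
  define L where "L y q gs = (if ?good q gs
      then laplace (rev gs) (map (eval_at q) (basis_enum q)) (y q)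
      else 0 * y q [])" for y :: "'q \<Rightarrow> (('v \<Rightarrow> complex) \<Rightarrow> complex) list \<Rightarrow> complex" and q gs
  show ?thesis
  proof (rule variety_morphism_linear[where L = L])
    show "multihomogeneous (\<lambda>k. if k = q then 1 else 0) (\<lambda>y. L y q gs)" for q gs
    proof (cases "?good q gs")
      case True
      then show ?thesis unfolding L_def if_P[OF True] by (intro multihomogeneous_laplace)
    next
      case False
      show ?thesis unfolding L_def if_not_P[OF False]
        by (rule multihomogeneous_scale[OF multihomogeneous.coord])
    qed
  next
    fix T y x assume T: "T \<in> A'" and y: "y \<in> plucker (dual_rep M) T"
      and x: "x \<in> plucker M (predual_subrep M T)"
    have T': "T \<in> quiver_Gr (dual_rep M) (\<lambda>q. dimension_vector M q - e q)" using A' T by blast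
    obtain us where us: "x = plucker_vector M us"
      "\<And>q. q \<in> verts_M \<Longrightarrow> distinct (us q)"
      "\<And>q. q \<in> verts_M \<Longrightarrow> is_basis_of (rep_scale M) (set (us q)) (predual_subrep M T q)"
      using x unfolding plucker_def by blast
    obtain fs where fs: "y = plucker_vector (dual_rep M) fs"
      "\<And>q. q \<in> verts_M \<Longrightarrow> distinct (fs q)"
      "\<And>q. q \<in> verts_M \<Longrightarrow> is_basis_of (\<lambda>c f x. c * f x) (set (fs q)) (T q)"
      using y unfolding plucker_def by auto
    have len: "length (us q) = e q" if q: "q \<in> verts_M" for q
      using length_basis[OF V.vector_space_axioms us(2,3)[OF q]]
        quiver_GrD(3)[OF predual_subrep_in_Gr[OF T' e] q] by simp
    have "\<exists>c. c \<noteq> 0 \<and> (\<forall>gs. set gs \<subseteq> dual_space M q \<and> length gs = length (us q) \<longrightarrow>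
        x q gs = c * laplace (rev gs) (map (eval_at q) (basis_enum q)) (y q))"
      if q: "q \<in> verts_M" for q
      unfolding us(1) fs(1)
      using us(3)[OF q] q
      by (intro plucker_coordinates[where us = us and fs = fs, OF q dual_quiver_GrD(1)[OF T' q] fs(2,3)[OF q] us(2)[OF q]])
        (simp add: predual_subrep_def)
    then obtain c where c: "\<And>q. q \<in> verts_M \<Longrightarrow> c q \<noteq> 0 \<and>
        (\<forall>gs. set gs \<subseteq> dual_space M q \<and> length gs = length (us q) \<longrightarrow>
          x q gs = c q * laplace (rev gs) (map (eval_at q) (basis_enum q)) (y q))"
      by metis
    define c' where "c' q = (if q \<in> verts_M then c q else 1)" for q
    have "x q gs = c' q * L y q gs" for q gs
    proof (cases "?good q gs")
      case True
      then show ?thesis unfolding L_def if_P[OF True] using c len by (simp add: c'_def)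
    next
      case False
      then have "x q gs = 0" unfolding us(1) plucker_vector_pairing using len by auto
      then show ?thesis unfolding L_def if_not_P[OF False] by simp
    qed
    moreover have "\<forall>q. c' q \<noteq> 0" using c by (simp add: c'_def)
    ultimately show "\<exists>c. (\<forall>q. c q \<noteq> 0) \<and> x = (\<lambda>q gs. c q * L y q gs)" by blast
  next
    show "plucker (dual_rep M) T \<noteq> {}" if "T \<in> A'" for T using dual_plucker_nonempty that A' by blast
    show "plucker M (predual_subrep M T) \<noteq> {}" if "T \<in> A'" for T
      using plucker_nonempty[OF predual_subrep_in_Gr[OF _ e]] that A' by blast
  qed (rule A)
qed

text \<open>Stated for arbitrary subsets of the two Grassmannians that correspond under
  annihilators, so that it covers both the whole Grassmannians and the Schubert cells.\<close>

lemma dual_subrep_isomorphism: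
  assumes e: "\<And>q. q \<in> verts_M \<Longrightarrow> e q \<le> dimension_vector M q"
    and A: "A \<subseteq> quiver_Gr M e"
    and A': "A' \<subseteq> quiver_Gr (dual_rep M) (\<lambda>q. dimension_vector M q - e q)"
    and F: "\<And>U. U \<in> A \<Longrightarrow> dual_subrep M U \<in> A'"
    and G: "\<And>T. T \<in> A' \<Longrightarrow> predual_subrep M T \<in> A"
  shows "variety_isomorphism (plucker M) A (plucker (dual_rep M)) A' (dual_subrep M)"
  unfolding variety_isomorphism_def
proof (intro conjI exI[of _ "predual_subrep M"] ballI)
  show "variety_morphism (plucker M) A (plucker (dual_rep M)) A' (dual_subrep M)"
    by (rule dual_subrep_morphism[OF A F])
  show "variety_morphism (plucker (dual_rep M)) A' (plucker M) A (predual_subrep M)"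
    by (rule predual_subrep_morphism[OF e A' G])
  show "predual_subrep M (dual_subrep M U) = U" if "U \<in> A" for U
    using predual_dual_subrep that A by blast
  show "dual_subrep M (predual_subrep M T) = T" if "T \<in> A'" for T
    using dual_predual_subrep that A' by blast
qed

section \<open>Schubert cells\<close>

lemma order_subset: "r \<subseteq> B \<times> B"
  using basis by (simp add: ordered_basis_def linear_order_on_def partial_order_on_def preorder_on_def)

text \<open>The dual order is given on functionals; injectivity of \<open>dual_vec\<close> on
  \<open>B\<close> recovers the underlying pair of basis elements.\<close>

lemma dual_order_iff:
  assumes "i \<in> B" "j \<in> B"
  shows "(dual_vec j, dual_vec i) \<in> dual_order M B r \<longleftrightarrow> (i, j) \<in> r"
proof
  assume "(dual_vec j, dual_vec i) \<in> dual_order M B r"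
  then obtain b b' where b: "dual_vec j = dual_vec b" "dual_vec i = dual_vec b'" "(b', b) \<in> r"
    by (auto simp: dual_order_def)
  then have "b \<in> B" "b' \<in> B" using order_subset by auto
  then show "(i, j) \<in> r" using b assms inj_dual_vec by (auto dest: inj_onD)
qed (auto simp: dual_order_def)

lemma dual_subset: "dual_subset M B \<beta> = dual_vec ` (B - \<beta>)" if "\<beta> \<subseteq> B"
proof -
  have "(\<forall>b\<in>\<beta>. dual_vec i b = 0) \<longleftrightarrow> i \<notin> \<beta>" if "i \<in> B" for i
    using dual_vec_apply[OF that] \<open>\<beta> \<subseteq> B\<close> by (auto simp: subset_iff)
  then show ?thesis by (auto simp: dual_subset_def dual_basis_def)
qed

text \<open>The dual cell in terms of \<open>\<B>\<close> itself: the order is reversed and \<open>\<beta>\<close> is complemented.\<close>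

lemma dual_schubert_cell_iff:
  assumes \<beta>: "\<beta> \<subseteq> B"
  shows "T \<in> schubert_cell (dual_rep M) (dual_basis M B) (dual_order M B r) e (dual_subset M B \<beta>) \<longleftrightarrow>
    T \<in> quiver_Gr (dual_rep M) e \<and> (\<forall>q\<in>verts_M. \<exists>w. is_basis_of (\<lambda>c f x. c * f x)
      ((\<lambda>i. dual_vec i + (\<Sum>j | j \<in> \<beta> \<inter> rep_space M q \<and> ((i, j) \<in> r \<and> j \<noteq> i). (\<lambda>x. w i j * dual_vec j x)))
        ` (basis_at q - \<beta> \<inter> rep_space M q)) (T q))"
proof -
  have "(\<exists>w. is_basis_of (\<lambda>c f x. c * f x)
      ((\<lambda>y. y + (\<Sum>y' | y' \<in> dual_basis M B \<inter> dual_space M q - dual_subset M B \<beta> \<and>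
            (y', y) \<in> dual_order M B r \<and> y' \<noteq> y. (\<lambda>x. w y' y * y' x)))
        ` (dual_subset M B \<beta> \<inter> dual_space M q)) (T q)) \<longleftrightarrow>
    (\<exists>w. is_basis_of (\<lambda>c f x. c * f x)
      ((\<lambda>i. dual_vec i + (\<Sum>j | j \<in> \<beta> \<inter> rep_space M q \<and> ((i, j) \<in> r \<and> j \<noteq> i). (\<lambda>x. w i j * dual_vec j x)))
        ` (basis_at q - \<beta> \<inter> rep_space M q)) (T q))"
    (is "(\<exists>w. ?P w) \<longleftrightarrow> (\<exists>w. ?Q w)")
    if q: "q \<in> verts_M" for q
  proof -
    let ?J = "\<beta> \<inter> rep_space M q"
    let ?K = "basis_at q - ?J"
    have J: "dual_basis M B \<inter> dual_space M q - dual_subset M B \<beta> = dual_vec ` ?J"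
    proof -
      have "dual_basis M B \<inter> dual_space M q = dual_vec ` basis_at q"
        using dual_vec_in_iff[OF q] by (auto simp: dual_basis_def)
      then show ?thesis
        using \<beta> inj_dual_vec unfolding dual_subset[OF \<beta>] by (auto simp: inj_on_def)
    qed
    have K: "dual_subset M B \<beta> \<inter> dual_space M q = dual_vec ` ?K"
      using dual_vec_in_iff[OF q] unfolding dual_subset[OF \<beta>] by auto
    have eq: "(\<lambda>y. y + (\<Sum>y' | y' \<in> dual_vec ` ?J \<and> (y', y) \<in> dual_order M B r \<and> y' \<noteq> y. (\<lambda>x. w y' y * y' x)))
        ` (dual_vec ` ?K) =
      (\<lambda>i. dual_vec i + (\<Sum>j | j \<in> ?J \<and> ((i, j) \<in> r \<and> j \<noteq> i).
        (\<lambda>x. w (dual_vec j) (dual_vec i) * dual_vec j x))) ` ?K" for w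
    proof -
      have JB: "?J \<subseteq> B" "?K \<subseteq> B" using \<beta> by auto
      have S: "{j. j \<in> ?J \<and> (dual_vec j, dual_vec i) \<in> dual_order M B r \<and> j \<noteq> i} =
          {j. j \<in> ?J \<and> ((i, j) \<in> r \<and> j \<noteq> i)}" if "i \<in> ?K" for i
        using dual_order_iff that \<beta> by auto
      show ?thesis
        unfolding echelon_reindex[OF inj_dual_vec JB, where s = "\<lambda>c f x. c * f x" and w = w]
        by (intro image_cong arg_cong2[of _ _ _ _ "(+)"] sum.cong refl S)
    qed
    show ?thesis
    proof
      assume "\<exists>w. ?P w"
      then obtain w where "?P w" ..
      then have "?Q (\<lambda>i j. w (dual_vec j) (dual_vec i))" unfolding J K eq .
      then show "\<exists>w. ?Q w" by (rule exI[of ?Q])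
    next
      assume "\<exists>w. ?Q w"
      then obtain w where w: "?Q w" ..
      \<comment> \<open>Coefficients in the dual cell are indexed by functionals; \<open>?i\<close>
        translates these back to basis elements.\<close>
      let ?i = "inv_into B dual_vec"
      have "(\<lambda>i. dual_vec i + (\<Sum>j | j \<in> ?J \<and> ((i, j) \<in> r \<and> j \<noteq> i).
            (\<lambda>x. w (?i (dual_vec i)) (?i (dual_vec j)) * dual_vec j x))) ` ?K =
          (\<lambda>i. dual_vec i + (\<Sum>j | j \<in> ?J \<and> ((i, j) \<in> r \<and> j \<noteq> i). (\<lambda>x. w i j * dual_vec j x))) ` ?K"
        using \<beta> by (intro image_cong refl arg_cong2[of _ _ _ _ "(+)"] sum.cong)
          (auto simp: inv_into_f_f[OF inj_dual_vec] subset_iff)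
      then have "?P (\<lambda>y' y. w (?i y) (?i y'))" unfolding J K eq using w by simp
      then show "\<exists>w. ?P w" by (rule exI[of ?P])
    qed
  qed
  then show ?thesis unfolding schubert_cell_def by simp
qed

text \<open>The echelon basis of the annihilator has coefficients \<open>- w i j\<close> with
  \<open>j\<close> in \<beta> above \<open>i\<close>, and these \<open>j\<close> have the smaller
  functionals in the dual order.\<close>

lemma dual_subrep_in_schubert_cell:
  assumes \<beta>: "\<beta> \<subseteq> B" and U: "U \<in> schubert_cell M B r e \<beta>"
  shows "dual_subrep M U \<in> schubert_cell (dual_rep M) (dual_basis M B) (dual_order M B r)
    (\<lambda>q. dimension_vector M q - e q) (dual_subset M B \<beta>)"
  unfolding dual_schubert_cell_iff[OF \<beta>]
proof (intro conjI ballI)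
  show "dual_subrep M U \<in> quiver_Gr (dual_rep M) (\<lambda>q. dimension_vector M q - e q)"
    using U dual_subrep_in_Gr by (simp add: schubert_cell_def)
  fix q assume q: "q \<in> verts_M"
  interpret P: dual_pair "rep_scale M" "\<lambda>c f x. c * f x" "rep_space M q" "dual_space M q" "\<lambda>f. f"
    "basis_at q" "\<lambda>b. b" dual_vec by (rule pair[OF q])
  let ?J = "\<beta> \<inter> rep_space M q"
  have J: "?J \<subseteq> basis_at q" using \<beta> by blast
  obtain w where w: "V.span ((\<lambda>b. b + (\<Sum>b' | b' \<in> basis_at q - \<beta> \<and> (b', b) \<in> r \<and> b' \<noteq> b.
      rep_scale M (w b' b) b')) ` ?J) = U q"
    using U q unfolding schubert_cell_def is_basis_of_def by blast
  have eq: "basis_at q - ?J = basis_at q - \<beta>" by blast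
  have "is_basis_of (\<lambda>c f x. c * f x)
      ((\<lambda>i. dual_vec i + (\<Sum>j | j \<in> ?J \<and> ((i, j) \<in> r \<and> i \<noteq> j). (\<lambda>x. - w i j * dual_vec j x))) ` (basis_at q - ?J))
      (annihilator (\<lambda>f. f) (dual_space M q) (U q))"
    by (rule P.echelon_annihilator[OF J, where R = "\<lambda>j i. (j, i) \<in> r \<and> j \<noteq> i"]) (use w in \<open>simp add: eq\<close>)
  moreover have "dual_subrep M U q = annihilator (\<lambda>f. f) (dual_space M q) (U q)"
    using q by (simp add: dual_subrep_annihilator)
  ultimately show "\<exists>w. is_basis_of (\<lambda>c f x. c * f x)
      ((\<lambda>i. dual_vec i + (\<Sum>j | j \<in> ?J \<and> ((i, j) \<in> r \<and> j \<noteq> i). (\<lambda>x. w i j * dual_vec j x)))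
        ` (basis_at q - ?J)) (dual_subrep M U q)"
    by (intro exI[of _ "\<lambda>i j. - w i j"]) (simp add: eq_commute)
qed

text \<open>\<open>echelon_annihilator\<close> for the swapped pairing, with \<beta> and its
  complement exchanged.\<close>

lemma predual_subrep_in_schubert_cell:
  assumes e: "\<And>q. q \<in> verts_M \<Longrightarrow> e q \<le> dimension_vector M q"
    and \<beta>: "\<beta> \<subseteq> B"
    and T: "T \<in> schubert_cell (dual_rep M) (dual_basis M B) (dual_order M B r)
      (\<lambda>q. dimension_vector M q - e q) (dual_subset M B \<beta>)"
  shows "predual_subrep M T \<in> schubert_cell M B r e \<beta>"
  unfolding schubert_cell_def
proof (intro CollectI conjI ballI)
  note T' = T[unfolded dual_schubert_cell_iff[OF \<beta>]]
  show "predual_subrep M T \<in> quiver_Gr M e"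
    using T' predual_subrep_in_Gr e by blast
  fix q assume q: "q \<in> verts_M"
  interpret P: dual_pair "rep_scale M" "\<lambda>c f x. c * f x" "rep_space M q" "dual_space M q" "\<lambda>f. f"
    "basis_at q" "\<lambda>b. b" dual_vec by (rule pair[OF q])
  interpret S: dual_pair "\<lambda>c f x. c * f x" "rep_scale M" "dual_space M q" "rep_space M q" "\<lambda>x f. f x"
    "basis_at q" dual_vec "\<lambda>b. b" by (rule P.swap)
  let ?J = "\<beta> \<inter> rep_space M q"
  let ?K = "basis_at q - ?J"
  have K: "basis_at q - ?K = ?J" using \<beta> by blast
  have K': "?K = basis_at q - \<beta>" "basis_at q - (basis_at q - \<beta>) = ?J" using \<beta> by blast+
  obtain w where w: "W.span ((\<lambda>i. dual_vec i + (\<Sum>j | j \<in> ?J \<and> ((i, j) \<in> r \<and> j \<noteq> i).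
      (\<lambda>x. w i j * dual_vec j x))) ` ?K) = T q"
    using T' q unfolding is_basis_of_def by blast
  \<comment> \<open>The dual echelon form sums over larger \<open>j\<close> with coefficient
    \<open>w i j\<close>, so both the relation and \<open>w\<close> enter with their arguments
    flipped; the conclusion then sums over smaller \<open>j\<close>.\<close>
  have "is_basis_of (rep_scale M)
      ((\<lambda>i. i + (\<Sum>j | j \<in> ?K \<and> ((j, i) \<in> r \<and> i \<noteq> j). rep_scale M (- w j i) j)) ` (basis_at q - ?K))
      (annihilator (\<lambda>x f. f x) (rep_space M q) (T q))"
    by (rule S.echelon_annihilator[where R = "\<lambda>j i. (i, j) \<in> r \<and> j \<noteq> i" and w = "\<lambda>j i. w i j"])
      (rule Diff_subset, simp only: K w)
  moreover have "predual_subrep M T q = annihilator (\<lambda>x f. f x) (rep_space M q) (T q)"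
    using q by (simp add: predual_subrep_def)
  ultimately show "\<exists>w. is_basis_of (rep_scale M)
      ((\<lambda>b. b + (\<Sum>b' | b' \<in> basis_at q - \<beta> \<and> (b', b) \<in> r \<and> b' \<noteq> b. rep_scale M (w b' b) b')) ` ?J)
      (predual_subrep M T q)"
    by (intro exI[of _ "\<lambda>j i. - w j i"]) (simp add: eq_commute K K')
qed

end

theorem theorem1p26:
  fixes M :: "('q, 'a, 'v::ab_group_add) quiver_rep"
    and B :: "'v set" and r :: "('v \<times> 'v) set"
    and e :: "'q \<Rightarrow> nat"
  assumes "is_rep M"
    and "\<nexists>p. pre_digraph.cycle (quiver M) p"
    and "finite_dimensional_rep M"
    and "ordered_basis M B r"
    and "\<forall>q\<in>verts (quiver M). e q \<le> dimension_vector M q"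
  shows "variety_isomorphism
           (plucker M) (quiver_Gr M e)
           (plucker (dual_rep M)) (quiver_Gr (dual_rep M) (\<lambda>q. dimension_vector M q - e q))
           (dual_subrep M)
         \<and>
         (\<forall>\<beta>\<subseteq>B. has_type M \<beta> e \<longrightarrow>
           variety_isomorphism
             (plucker M) (schubert_cell M B r e \<beta>)
             (plucker (dual_rep M))
             (schubert_cell (dual_rep M) (dual_basis M B) (dual_order M B r)
                (\<lambda>q. dimension_vector M q - e q) (dual_subset M B \<beta>))
             (dual_subrep M))"
proof -
  interpret based_rep M B r using assms(1,3,4) by unfold_locales
  have e: "e q \<le> dimension_vector M q" if "q \<in> verts_M" for q using assms(5) that by blast
  show ?thesis
  proof (intro conjI allI impI)
    show "variety_isomorphism (plucker M) (quiver_Gr M e)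
        (plucker (dual_rep M)) (quiver_Gr (dual_rep M) (\<lambda>q. dimension_vector M q - e q)) (dual_subrep M)"
      by (rule dual_subrep_isomorphism[OF e order_refl order_refl dual_subrep_in_Gr predual_subrep_in_Gr[OF _ e]])
    fix \<beta> assume \<beta>: "\<beta> \<subseteq> B"
    show "variety_isomorphism (plucker M) (schubert_cell M B r e \<beta>) (plucker (dual_rep M))
        (schubert_cell (dual_rep M) (dual_basis M B) (dual_order M B r)
          (\<lambda>q. dimension_vector M q - e q) (dual_subset M B \<beta>)) (dual_subrep M)"
    \<comment> \<open>It remains to see that the cells lie in the Grassmannians and are carried into
      each other by annihilators in both directions.\<close>
    proof (rule dual_subrep_isomorphism[OF e])
      show "schubert_cell M B r e \<beta> \<subseteq> quiver_Gr M e"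
        by (auto simp: schubert_cell_def)
      show "schubert_cell (dual_rep M) (dual_basis M B) (dual_order M B r)
          (\<lambda>q. dimension_vector M q - e q) (dual_subset M B \<beta>)
        \<subseteq> quiver_Gr (dual_rep M) (\<lambda>q. dimension_vector M q - e q)"
        by (auto simp: schubert_cell_def)
    qed (use dual_subrep_in_schubert_cell[OF \<beta>] predual_subrep_in_schubert_cell[OF e \<beta>] in auto)
  qed
qed

end
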